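(* For $1\le j\le N$ let $\Omega_j$ be a compact subset of $\mathbb C$ supporting a non-atomic finite measure $m_j$ satisfying condition (A) with exponent $\delta_j$, and let $\Omega=\Omega_1\times\dots\times\Omega_N\subseteq\mathbb C^N$. Then for every $N$-tuple $(i_1,\dots,i_N)$ with $i_j\ge0$ and $\sum_j i_j=1$, $$\dim\big(\mathrm{Bad}_{\mathbb C}(i_1,\dots,i_N)\cap\Omega\big)=\dim\Omega.$$
   Context: $\dim$ is Hausdorff dimension ($\mathbb C$ with the usual metric, $\mathbb C^N$ with the maximum of the coordinate metrics). Condition (A) with exponent $\delta$ for $\mu$ supported on compact $\Omega'\subseteq\mathbb C$: there are $r_0>0$, $0<a\le1\le b$ with $ar^\delta\le\mu(B(c,r))\le br^\delta$ for $c\in\Omega'$, $r\le r_0$. $\mathbb Z[i]$ is the ring of Gaussian integers. $\mathrm{Bad}_{\mathbb C}(i_1,\dots,i_N)$ is the set of $z=(z_1,\dots,z_N)\in\mathbb C^N$ for which there is $c(z)>0$ such that for all $q,p_1,\dots,p_N\in\mathbb Z[i]$ with $q\ne0$, $\max\{|qz_1-p_1|^{1/i_1},\dots,|qz_N-p_N|^{1/i_N}\}\ge c(z)|q|^{-1}$, where terms with $i_s=0$ are omitted from the maximum. *)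

theory Defs
  imports "HOL-Analysis.Analysis" "HOL-Probability.Probability"
begin

text \<open>Diameter of a set w.r.t. a distance function d (extended, so unbounded sets have diameter top;
  the empty set has diameter 0).\<close>
definition diamE :: "('a \<Rightarrow> 'a \<Rightarrow> real) \<Rightarrow> 'a set \<Rightarrow> ennreal" where
  "diamE d U = (SUP x\<in>U. SUP y\<in>U. ennreal (d x y))"

definition cover_term :: "('a \<Rightarrow> 'a \<Rightarrow> real) \<Rightarrow> real \<Rightarrow> 'a set \<Rightarrow> ennreal" where
  "cover_term d s U =
     (if U = {} then 0 else if s = 0 then 1 else ennreal (enn2real (diamE d U) powr s))"

definition hausdorff_approx :: "('a \<Rightarrow> 'a \<Rightarrow> real) \<Rightarrow> real \<Rightarrow> real \<Rightarrow> 'a set \<Rightarrow> ennreal" where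
  "hausdorff_approx d s \<delta> S =
     (INF U \<in> {U :: nat \<Rightarrow> 'a set. S \<subseteq> (\<Union>k. U k) \<and> (\<forall>k. diamE d (U k) \<le> ennreal \<delta>)}.
        (\<Sum>k. cover_term d s (U k)))"

definition hausdorff_outer :: "('a \<Rightarrow> 'a \<Rightarrow> real) \<Rightarrow> real \<Rightarrow> 'a set \<Rightarrow> ennreal" where
  "hausdorff_outer d s S = (SUP \<delta> \<in> {0<..}. hausdorff_approx d s \<delta> S)"

definition hausdorff_dim :: "('a \<Rightarrow> 'a \<Rightarrow> real) \<Rightarrow> 'a set \<Rightarrow> real" where
  "hausdorff_dim d S = Inf {s. 0 \<le> s \<and> hausdorff_outer d s S = 0}"

definition dist_max :: "('n::finite \<Rightarrow> complex) \<Rightarrow> ('n \<Rightarrow> complex) \<Rightarrow> real" where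
  "dist_max z w = Max (range (\<lambda>j. cmod (z j - w j)))"

definition gaussian_ints :: "complex set" where
  "gaussian_ints = {z. Re z \<in> \<int> \<and> Im z \<in> \<int>}"

definition Bad_C :: "('n::finite \<Rightarrow> real) \<Rightarrow> ('n \<Rightarrow> complex) set" where
  "Bad_C i = {z. \<exists>c>0. \<forall>q p. q \<in> gaussian_ints \<longrightarrow> q \<noteq> 0 \<longrightarrow> (\<forall>s. p s \<in> gaussian_ints) \<longrightarrow>
      Max ((\<lambda>s. cmod (q * z s - p s) powr (1 / i s)) ` {s. i s \<noteq> 0}) \<ge> c / cmod q}"

definition condition_A :: "complex measure \<Rightarrow> complex set \<Rightarrow> real \<Rightarrow> bool" where
  "condition_A \<mu> \<Omega>' \<delta> \<longleftrightarrow> (\<exists>r0>0. \<exists>a b. 0 < a \<and> a \<le> 1 \<and> 1 \<le> b \<and>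
     (\<forall>c\<in>\<Omega>'. \<forall>r. 0 < r \<and> r \<le> r0 \<longrightarrow>
        ennreal (a * r powr \<delta>) \<le> emeasure \<mu> (ball c r) \<and>
        emeasure \<mu> (ball c r) \<le> ennreal (b * r powr \<delta>)))"

end

theory Submission
  imports Defs
begin

text \<open>Counting separated points in each coordinate bounds the box-counting dimension of \<open>\<Omega>\<close> by
  \<open>\<Delta> = \<Sum>j. \<delta> j\<close>, so it suffices to find, for every \<open>t < \<Delta>\<close>, a probability measure on \<open>Bad \<inter> \<Omega>\<close> giving mass \<open>O(r^t)\<close> to sets of diameter \<open>r\<close>.
  Its support is a Cantor set of nested boxes, those of generation \<open>n\<close> having sides \<open>\<epsilon> R^(-n(1 + i j))\<close>
  with \<open>\<epsilon> = 1/(40 N R^2)\<close>. The rational points \<open>p/q\<close> with \<open>|q| < R^(n+1)\<close> close to such a box all lie on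
  one hyperplane: by the pigeonhole principle there are Gaussian integers \<open>\<alpha>\<close>, \<open>\<beta>\<close> for which the
  linear form \<open>q (\<alpha> z + \<beta>)\<close> has modulus less than 1 at all these points, where it is a Gaussian integer.
  A neighbourhood of a hyperplane meets few of the subboxes centred in \<open>\<Omega>\<close>, so discarding these
  leaves at least \<open>\<kappa> R^(\<Sum>j. (1 + i j) \<delta> j)\<close> children, with \<open>\<kappa>\<close> independent of \<open>R\<close>. The loss \<open>\<kappa>\<close> per generation
  costs an arbitrarily small power of \<open>r\<close> once \<open>R\<close> is large.\<close>

subsection \<open>Covers and Hausdorff measure\<close>

lemma diamE_leI:
  assumes "\<And>x y. x \<in> U \<Longrightarrow> y \<in> U \<Longrightarrow> d x y \<le> r"
  shows "diamE d U \<le> ennreal r"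
  unfolding diamE_def using assms by (intro SUP_least ennreal_leI)

lemma diamE_leD:
  assumes "diamE d U \<le> ennreal r" "0 \<le> r" "x \<in> U" "y \<in> U"
  shows "d x y \<le> r"
proof -
  have "ennreal (d x y) \<le> diamE d U"
    unfolding diamE_def using assms by (intro SUP_upper2[of x] SUP_upper2[of y]) auto
  also note assms(1)
  finally show ?thesis using assms(2) by simp
qed

text \<open>Powers of a number at most 1 decrease in the exponent. With \<open>0 < t\<close> the
  power is also at most 1, which is what a nonempty set counts for \<open>s = 0\<close>.\<close>

lemma diam_powr_le_cover_term:
  assumes "diamE d U \<le> 1" "s \<le> t" "0 < t"
  shows "ennreal (enn2real (diamE d U) powr t) \<le> cover_term d s U"
proof (cases "U = {}")
  case True
  then show ?thesis by (simp add: diamE_def cover_term_def bot_ennreal)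
next
  case False
  have "enn2real (diamE d U) \<le> 1" using assms(1) by (simp add: enn2real_leI)
  then have "enn2real (diamE d U) powr t \<le> 1" "enn2real (diamE d U) powr t \<le> enn2real (diamE d U) powr s"
    using assms(2,3) by (auto intro!: powr_le1 powr_mono')
  then show ?thesis using False by (auto simp: cover_term_def ennreal_leI)
qed

text \<open>A cover of very small \<open>s\<close>-cost would have total mass below 1, since each
  covering set carries mass at most \<open>C\<close> times its diameter to the power
  \<open>t\<close>. The mass lives on a parameter space and reaches \<open>S\<close> through
  \<open>\<xi>\<close>; asking only for a measurable superset \<open>A\<close> of each preimage
  avoids measurability of \<open>\<xi>\<close> and \<open>U\<close>.\<close>

lemma mass_distribution_principle:
  fixes d :: "'a \<Rightarrow> 'a \<Rightarrow> real"
  assumes "prob_space M" and "0 < r1" "r1 \<le> 1" "0 < t" "s \<le> t" "0 \<le> C"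
    and S: "\<And>\<omega>. \<omega> \<in> space M \<Longrightarrow> \<xi> \<omega> \<in> S"
    and mass: "\<And>U r. diamE d U \<le> ennreal r \<Longrightarrow> 0 < r \<Longrightarrow> r \<le> r1 \<Longrightarrow>
      \<exists>A\<in>sets M. {\<omega>\<in>space M. \<xi> \<omega> \<in> U} \<subseteq> A \<and> measure M A \<le> C * r powr t"
  shows "hausdorff_outer d s S \<noteq> 0"
proof
  interpret prob_space M by fact
  \<comment> \<open>Both the cost of the cover and the sum of the enlargements below are at most
    \<open>e\<close>; the choice makes \<open>C * (e + e) < 1\<close>.\<close>
  define e where "e = 1 / (4 * (C + 1))"
  have "0 < e" using \<open>0 \<le> C\<close> by (simp add: e_def)
  assume "hausdorff_outer d s S = 0"
  then have "hausdorff_approx d s r1 S \<le> 0"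
    using \<open>0 < r1\<close> unfolding hausdorff_outer_def by (metis SUP_upper greaterThan_iff)
  then have "hausdorff_approx d s r1 S < ennreal e"
    using \<open>0 < e\<close> by simp
  then obtain U where cover: "S \<subseteq> (\<Union>k. U k)" and diam: "\<And>k. diamE d (U k) \<le> ennreal r1"
    and small: "(\<Sum>k. cover_term d s (U k)) < ennreal e"
    unfolding hausdorff_approx_def by (auto simp: INF_less_iff)
  have "\<exists>A. A \<in> sets M \<and> {\<omega>\<in>space M. \<xi> \<omega> \<in> U k} \<subseteq> A \<and>
      emeasure M A \<le> ennreal C * (cover_term d s (U k) + ennreal (e * (1 / 2) ^ Suc k))" for k
  proof -
    \<comment> \<open>Slightly enlarging the diameter takes care of sets consisting of a single point.\<close>
    define D \<eta> where "D = enn2real (diamE d (U k))" and "\<eta> = e * (1 / 2) ^ Suc k"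
    define r where "r = min r1 ((D powr t + \<eta>) powr (1 / t))"
    have "0 \<le> D" "0 < \<eta>" using \<open>0 < e\<close> by (auto simp: D_def \<eta>_def)
    have D: "diamE d (U k) = ennreal D" unfolding D_def
      using diam[of k] by (simp add: ennreal_enn2real_if) (metis ennreal_neq_top top.extremum_uniqueI)
    have "D = (D powr t) powr (1 / t)" using \<open>0 \<le> D\<close> \<open>0 < t\<close> by (simp add: powr_powr)
    also have "\<dots> \<le> (D powr t + \<eta>) powr (1 / t)"
      using \<open>0 < \<eta>\<close> \<open>0 < t\<close> by (intro powr_mono2) auto
    finally have "D \<le> r" using diam[of k] \<open>0 < r1\<close> by (simp add: r_def D)
    have "0 < D powr t + \<eta>" using \<open>0 < \<eta>\<close> by (simp add: add_nonneg_pos)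
    then have "0 < r" using \<open>0 < r1\<close> by (simp add: r_def)
    have "r powr t \<le> ((D powr t + \<eta>) powr (1 / t)) powr t"
      using \<open>0 < r\<close> \<open>0 < t\<close> by (intro powr_mono2) (auto simp: r_def)
    also have "\<dots> = D powr t + \<eta>" using \<open>0 < t\<close> \<open>0 < D powr t + \<eta>\<close> by (simp add: powr_powr)
    finally have "ennreal (r powr t) \<le> ennreal (D powr t) + ennreal \<eta>"
      using \<open>0 < \<eta>\<close> by (simp flip: ennreal_plus)
    also have "ennreal (D powr t) \<le> cover_term d s (U k)"
      unfolding D_def using order_trans[OF diam[of k], of 1] \<open>r1 \<le> 1\<close> assms(4,5)
      by (intro diam_powr_le_cover_term) simp_all
    finally have r_le: "ennreal (r powr t) \<le> cover_term d s (U k) + ennreal \<eta>" by (simp add: add_right_mono)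
    have "diamE d (U k) \<le> ennreal r" using \<open>D \<le> r\<close> by (simp add: D ennreal_leI)
    with mass[of "U k" r] \<open>0 < r\<close> obtain A where A: "A \<in> sets M" "{\<omega>\<in>space M. \<xi> \<omega> \<in> U k} \<subseteq> A"
      "measure M A \<le> C * r powr t" by (auto simp: r_def)
    have "emeasure M A \<le> ennreal C * ennreal (r powr t)"
      using A(3) \<open>0 \<le> C\<close> by (simp add: emeasure_eq_measure flip: ennreal_mult)
    also have "\<dots> \<le> ennreal C * (cover_term d s (U k) + ennreal \<eta>)" by (intro mult_left_mono r_le) simp
    finally show ?thesis using A(1,2) unfolding \<eta>_def by blast
  qed
  then have "\<forall>k. \<exists>A. A \<in> sets M \<and> {\<omega>\<in>space M. \<xi> \<omega> \<in> U k} \<subseteq> A \<and>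
      emeasure M A \<le> ennreal C * (cover_term d s (U k) + ennreal (e * (1 / 2) ^ Suc k))" by blast
  from choice[OF this] obtain A where A: "\<And>k. A k \<in> sets M" "\<And>k. {\<omega>\<in>space M. \<xi> \<omega> \<in> U k} \<subseteq> A k"
    "\<And>k. emeasure M (A k) \<le> ennreal C * (cover_term d s (U k) + ennreal (e * (1 / 2) ^ Suc k))"
    by blast
  have "space M \<subseteq> (\<Union>k. A k)" using S cover A(2) by blast
  then have "1 \<le> emeasure M (\<Union>k. A k)"
    using A(1) emeasure_mono[of "space M" "\<Union>k. A k" M] by (simp add: emeasure_space_1)
  also have "\<dots> \<le> (\<Sum>k. emeasure M (A k))" using A(1) by (intro emeasure_subadditive_countably) auto
  also have "\<dots> \<le> (\<Sum>k. ennreal C * (cover_term d s (U k) + ennreal (e * (1 / 2) ^ Suc k)))"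
    by (intro suminf_le A) auto
  also have "\<dots> = ennreal C * ((\<Sum>k. cover_term d s (U k)) + (\<Sum>k. ennreal (e * (1 / 2) ^ Suc k)))"
    by (simp add: suminf_add)
  also have "(\<Sum>k. ennreal (e * (1 / 2) ^ Suc k)) = ennreal e"
    using \<open>0 < e\<close> sums_mult[OF power_half_series, of e] by (intro suminf_ennreal_eq) auto
  also have "ennreal C * ((\<Sum>k. cover_term d s (U k)) + ennreal e) \<le> ennreal C * (ennreal e + ennreal e)"
    using small by (intro mult_left_mono add_right_mono) auto
  also have "\<dots> = ennreal (C * (e + e))"
    using \<open>0 < e\<close> \<open>0 \<le> C\<close> by (simp add: ennreal_mult flip: ennreal_plus)
  also have "\<dots> < 1" using \<open>0 \<le> C\<close> by (simp add: e_def ennreal_less_one_iff field_simps)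
  finally show False by simp
qed

text \<open>Box counting: at scale \<open>4 * h\<close> the cover costs at most
  \<open>C * 4 powr s * h powr (s - D)\<close>, which tends to 0 with \<open>h\<close>.\<close>

lemma hausdorff_outer_eq_0:
  assumes "D < s" "0 < s" "0 \<le> C"
    and cover: "\<And>h. 0 < h \<Longrightarrow> h \<le> 1 \<Longrightarrow> \<exists>F. finite F \<and> S \<subseteq> \<Union>F \<and>
      (\<forall>U\<in>F. diamE d U \<le> ennreal (4 * h)) \<and> real (card F) * h powr D \<le> C"
  shows "hausdorff_outer d s S = 0"
proof -
  have bound: "hausdorff_approx d s \<rho> S \<le> ennreal (C * 4 powr s * h powr (s - D))"
    if h: "0 < h" "h \<le> 1" "4 * h \<le> \<rho>" for \<rho> h
  proof -
    from cover[OF h(1,2)] obtain F where F: "finite F" "S \<subseteq> \<Union>F"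
      "\<And>U. U \<in> F \<Longrightarrow> diamE d U \<le> ennreal (4 * h)" "real (card F) * h powr D \<le> C" by blast
    from ex_bij_betw_nat_finite[OF F(1)] obtain g where g: "bij_betw g {0..<card F} F" by blast
    \<comment> \<open>Covers in the definition are sequences, so the finite family is padded with
      empty sets, which cost 0.\<close>
    define U where "U = (\<lambda>k. if k < card F then g k else {})"
    have gF: "g k \<in> F" if "k < card F" for k using g that by (auto simp: bij_betw_def)
    have "g ` {..<card F} = F" using bij_betw_imp_surj_on[OF g] by (simp add: lessThan_atLeast0)
    then have "(\<Union>k<card F. U k) = \<Union>F" by (simp add: U_def)
    with F(2) have "S \<subseteq> (\<Union>k. U k)" by blast
    moreover have "diamE d (U k) \<le> ennreal \<rho>" for k
    proof (cases "k < card F")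
      case True
      then show ?thesis
        using order_trans[OF F(3)[OF gF[OF True]] ennreal_leI[OF h(3)]] by (simp add: U_def)
    qed (simp add: U_def diamE_def bot_ennreal)
    ultimately have "hausdorff_approx d s \<rho> S \<le> (\<Sum>k. cover_term d s (U k))"
      unfolding hausdorff_approx_def by (intro INF_lower) auto
    also have "\<dots> = (\<Sum>k<card F. cover_term d s (U k))"
      by (intro suminf_finite) (auto simp: U_def cover_term_def)
    also have "\<dots> \<le> (\<Sum>k<card F. ennreal ((4 * h) powr s))"
    proof (rule sum_mono)
      fix k assume "k \<in> {..<card F}"
      then have "diamE d (U k) \<le> ennreal (4 * h)" using F(3)[OF gF, of k] by (simp add: U_def)
      then have "enn2real (diamE d (U k)) \<le> 4 * h" using h by (simp add: enn2real_leI)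
      then have "enn2real (diamE d (U k)) powr s \<le> (4 * h) powr s"
        using \<open>0 < s\<close> by (intro powr_mono2) auto
      then show "cover_term d s (U k) \<le> ennreal ((4 * h) powr s)"
        using \<open>0 < s\<close> by (simp add: cover_term_def ennreal_leI)
    qed
    also have "\<dots> = ennreal (real (card F) * (4 * h) powr s)"
      by (simp add: ennreal_mult flip: ennreal_of_nat_eq_real_of_nat)
    also have "\<dots> = ennreal ((real (card F) * h powr D) * (4 powr s * h powr (s - D)))"
      using h by (simp add: powr_mult powr_diff)
    also have "\<dots> \<le> ennreal (C * (4 powr s * h powr (s - D)))"
      by (intro ennreal_leI mult_right_mono F) auto
    finally show ?thesis by (simp add: mult_ac)
  qed
  have lim: "((\<lambda>h. C * 4 powr s * h powr (s - D)) \<longlongrightarrow> 0) (at_right 0)"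
  proof -
    have "((\<lambda>h. h powr (s - D)) \<longlongrightarrow> 0 powr (s - D)) (at_right 0)"
      using \<open>D < s\<close> by (intro tendsto_powr') (auto simp: eventually_at_right_less intro!: eventually_at_rightI[of 0 1])
    then show ?thesis by (intro tendsto_mult_right_zero) simp
  qed
  have "hausdorff_approx d s \<rho> S \<le> ennreal e" if "0 < \<rho>" "0 < e" for \<rho> e
  proof -
    have "\<forall>\<^sub>F h in at_right 0. C * 4 powr s * h powr (s - D) < e"
      using order_tendstoD(2)[OF lim \<open>0 < e\<close>] .
    moreover have "\<forall>\<^sub>F h in at_right 0. 0 < h \<and> h < min 1 (\<rho> / 4)"
      using \<open>0 < \<rho>\<close> by (intro eventually_at_rightI[of 0 "min 1 (\<rho> / 4)"]) auto
    ultimately have "\<forall>\<^sub>F h in at_right 0. C * 4 powr s * h powr (s - D) < e \<and> 0 < h \<and> h < min 1 (\<rho> / 4)"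
      by (rule eventually_conj)
    then obtain h where h: "C * 4 powr s * h powr (s - D) < e" "0 < h" "h < min 1 (\<rho> / 4)"
      using eventually_happens'[OF trivial_limit_at_right_real[of "0::real"]] by blast
    have "hausdorff_approx d s \<rho> S \<le> ennreal (C * 4 powr s * h powr (s - D))"
      using h by (intro bound) auto
    also have "\<dots> \<le> ennreal e" using h by (intro ennreal_leI) auto
    finally show ?thesis .
  qed
  then have "hausdorff_approx d s \<rho> S \<le> 0" if "0 < \<rho>" for \<rho>
    using ennreal_le_epsilon[of 0 "hausdorff_approx d s \<rho> S"] that by simp
  then show ?thesis unfolding hausdorff_outer_def by (intro antisym SUP_least) auto
qed

subsection \<open>Ahlfors regular measures\<close>

lemma (in finite_measure) card_disjoint_family_le:
  assumes "finite E" and "disjoint_family_on B E"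
    and "\<And>x. x \<in> E \<Longrightarrow> B x \<in> sets M" and "\<And>x. x \<in> E \<Longrightarrow> B x \<subseteq> V" and "V \<in> sets M"
    and "\<And>x. x \<in> E \<Longrightarrow> \<alpha> \<le> measure M (B x)"
  shows "real (card E) * \<alpha> \<le> measure M V"
proof -
  have "real (card E) * \<alpha> = (\<Sum>x\<in>E. \<alpha>)" by simp
  also have "\<dots> \<le> (\<Sum>x\<in>E. measure M (B x))" by (intro sum_mono assms)
  also have "\<dots> = measure M (\<Union>x\<in>E. B x)"
    using assms by (intro finite_measure_finite_Union[symmetric]) auto
  also have "\<dots> \<le> measure M V" using assms by (intro finite_measure_mono) auto
  finally show ?thesis .
qed

text \<open>Condition (A) with the threshold \<open>r0\<close> absorbed into the constants: the
  lower bound holds up to radius 1 and the upper bound at every radius, so the counting arguments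
  below have no threshold to track.\<close>

locale ahlfors_regular = finite_measure \<mu>
  for \<mu> :: "'a::metric_space measure" +
  fixes \<Omega> :: "'a set" and \<delta> a b :: real
  assumes sets_eq: "sets \<mu> = sets borel"
    and null: "emeasure \<mu> (UNIV - \<Omega>) = 0"
    and closed: "closed \<Omega>"
    and exponent_pos: "0 < \<delta>" and a_pos: "0 < a" and b_pos: "0 < b"
    and lower: "\<And>c r. c \<in> \<Omega> \<Longrightarrow> 0 < r \<Longrightarrow> r \<le> 1 \<Longrightarrow> a * r powr \<delta> \<le> measure \<mu> (ball c r)"
    and upper: "\<And>c r. c \<in> \<Omega> \<Longrightarrow> 0 < r \<Longrightarrow> measure \<mu> (ball c r) \<le> b * r powr \<delta>"
begin

lemma space_eq: "space \<mu> = UNIV"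
  using sets_eq_imp_space_eq[OF sets_eq] by simp

lemma measure_Int_support:
  assumes "A \<in> sets \<mu>"
  shows "measure \<mu> (A \<inter> \<Omega>) = measure \<mu> A"
proof -
  have "UNIV - \<Omega> \<in> null_sets \<mu>"
    using null closed by (simp add: null_sets_def sets_eq borel_closed)
  then have "measure \<mu> (A - (UNIV - \<Omega>)) = measure \<mu> A"
    using assms by (intro measure_Diff_null_set)
  moreover have "A - (UNIV - \<Omega>) = A \<inter> \<Omega>" by auto
  ultimately show ?thesis by simp
qed

text \<open>Packing: the balls of radius \<open>h\<close> about the points are disjoint and each has
  mass at least \<open>a * h powr \<delta>\<close>.\<close>

lemma card_separated_le_measure:
  assumes "finite E" "E \<subseteq> \<Omega>" "0 < h" "h \<le> 1"
    and sep: "pairwise (\<lambda>x y. 2 * h < dist x y) E"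
    and "\<And>x. x \<in> E \<Longrightarrow> ball x h \<subseteq> V" "V \<in> sets \<mu>"
  shows "real (card E) * (a * h powr \<delta>) \<le> measure \<mu> V"
proof (rule card_disjoint_family_le[where B = "\<lambda>x. ball x h"])
  have "ball x h \<inter> ball y h = {}" if "x \<in> E" "y \<in> E" "x \<noteq> y" for x y
    using pairwiseD[OF sep that] by (intro disjoint_ballI) simp
  then show "disjoint_family_on (\<lambda>x. ball x h) E"
    by (auto simp: disjoint_family_on_def)
qed (use assms lower in \<open>auto simp: sets_eq subset_iff\<close>)

text \<open>All the disjoint balls lie in one ball of radius \<open>2 * t\<close> about a point of
  \<open>E\<close>, so the upper bound on its mass limits their number to a multiple of
  \<open>(t / h) powr \<delta>\<close>.\<close>

lemma card_separated_le:
  assumes "finite E" "E \<subseteq> \<Omega>" "0 < h" "h \<le> 1" "h \<le> t"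
    and sep: "pairwise (\<lambda>x y. 2 * h < dist x y) E"
    and diam: "\<And>x y. x \<in> E \<Longrightarrow> y \<in> E \<Longrightarrow> dist x y \<le> t"
  shows "real (card E) * (a * h powr \<delta>) \<le> b * (2 * t) powr \<delta>"
proof (cases "E = {}")
  case True
  then show ?thesis using b_pos by simp
next
  case False
  then obtain c where c: "c \<in> E" by blast
  have "ball x h \<subseteq> ball c (2 * t)" if "x \<in> E" for x
    using diam[OF c that] assms(5) by (smt (verit) mem_ball dist_triangle subsetI)
  then have "real (card E) * (a * h powr \<delta>) \<le> measure \<mu> (ball c (2 * t))"
    using assms by (intro card_separated_le_measure[of E]) (auto simp: sets_eq)
  also have "\<dots> \<le> b * (2 * t) powr \<delta>"
    using c assms by (intro upper) auto
  finally show ?thesis .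
qed

text \<open>The packing bound limits the size of separated sets, so there is one of maximal
  cardinality; a point of \<open>A\<close> far from all its members could be added to it.\<close>

lemma maximal_separated_subset:
  assumes "A \<subseteq> \<Omega>" "0 < h" "h \<le> 1"
  obtains E where "finite E" "E \<subseteq> A" "pairwise (\<lambda>x y. 2 * h < dist x y) E"
    "\<And>x. x \<in> A \<Longrightarrow> \<exists>y\<in>E. dist x y \<le> 2 * h"
proof -
  let ?P = "\<lambda>n. \<exists>E. finite E \<and> E \<subseteq> A \<and> pairwise (\<lambda>x y. 2 * h < dist x y) E \<and> card E = n"
  have bound: "n \<le> nat \<lceil>measure \<mu> UNIV / (a * h powr \<delta>)\<rceil>" if "?P n" for n
  proof -
    from that obtain E where E: "finite E" "E \<subseteq> A" "pairwise (\<lambda>x y. 2 * h < dist x y) E" "card E = n"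
      by blast
    have "real n * (a * h powr \<delta>) \<le> measure \<mu> UNIV"
      using card_separated_le_measure[of E h UNIV] E assms by (auto simp: sets_eq)
    then have "real n \<le> measure \<mu> UNIV / (a * h powr \<delta>)"
      using a_pos assms by (simp add: field_simps)
    then show ?thesis by linarith
  qed
  moreover have "?P 0" by (intro exI[of _ "{}"]) auto
  ultimately obtain n where n: "?P n" "\<And>n'. ?P n' \<Longrightarrow> n' \<le> n"
    using Nat.ex_has_greatest_nat[of ?P 0 "nat \<lceil>measure \<mu> UNIV / (a * h powr \<delta>)\<rceil>"] by blast
  then obtain E where E: "finite E" "E \<subseteq> A" "pairwise (\<lambda>x y. 2 * h < dist x y) E" "card E = n"
    by blast
  have "\<exists>y\<in>E. dist x y \<le> 2 * h" if "x \<in> A" for x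
  proof (rule ccontr)
    assume far: "\<not> ?thesis"
    then have "x \<notin> E" using assms by force
    then have "?P (Suc n)"
      using E far that
      by (intro exI[of _ "insert x E"]) (auto simp: pairwise_insert not_le dist_commute)
    then show False using n(2) by fastforce
  qed
  then show thesis using that E by blast
qed

text \<open>Masses are compared: points within \<open>2 * h\<close> of a net point lie in the open
  ball of radius \<open>3 * h\<close> about it, to which \<open>upper\<close> applies. Covering
  \<open>\<Omega>\<close> inside the ball suffices, as the rest is null.\<close>

lemma card_cover_ge:
  assumes "c \<in> \<Omega>" "0 < r" "r \<le> 1" "0 < h" "finite E" "E \<subseteq> \<Omega>"
    and cover: "\<And>x. x \<in> \<Omega> \<Longrightarrow> x \<in> ball c r \<Longrightarrow> \<exists>y\<in>E. dist x y \<le> 2 * h"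
  shows "a * r powr \<delta> \<le> real (card E) * (b * (3 * h) powr \<delta>)"
proof -
  have "a * r powr \<delta> \<le> measure \<mu> (ball c r \<inter> \<Omega>)"
    using lower assms by (simp add: measure_Int_support sets_eq)
  also have "\<dots> \<le> measure \<mu> (\<Union>y\<in>E. ball y (3 * h))"
    using cover \<open>0 < h\<close> \<open>finite E\<close>
    by (intro finite_measure_mono) (fastforce simp: sets_eq dist_commute)+
  also have "\<dots> \<le> (\<Sum>y\<in>E. measure \<mu> (ball y (3 * h)))"
    using \<open>finite E\<close> by (intro finite_measure_subadditive_finite) (auto simp: sets_eq)
  also have "\<dots> \<le> (\<Sum>y\<in>E. b * (3 * h) powr \<delta>)"
    using assms by (intro sum_mono upper) auto
  finally show ?thesis by simp
qed

end

section \<open>Products of regular measures\<close>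

locale ahlfors_regular_family =
  fixes m :: "'n::finite \<Rightarrow> 'a::metric_space measure" and \<Omega>s :: "'n \<Rightarrow> 'a set"
    and \<delta> a b :: "'n \<Rightarrow> real"
  assumes regular: "\<And>j. ahlfors_regular (m j) (\<Omega>s j) (\<delta> j) (a j) (b j)"
begin

lemma pos: "0 < a j" "0 < b j" "0 < \<delta> j"
  using regular[of j] by (auto simp: ahlfors_regular_def ahlfors_regular_axioms_def)

text \<open>The packing argument for boxes with different side lengths: the product measure of a box
  factors, and centres that are far apart in a single coordinate already have disjoint
  boxes.\<close>

lemma card_box_separated_le:
  assumes "finite E" "\<And>x j. x \<in> E \<Longrightarrow> x j \<in> \<Omega>s j" "\<And>j. 0 < h j" "\<And>j. h j \<le> 1" "\<And>j. h j \<le> t"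
    and sep: "pairwise (\<lambda>x y. \<exists>j. 2 * h j < dist (x j) (y j)) E"
    and diam: "\<And>x y j. x \<in> E \<Longrightarrow> y \<in> E \<Longrightarrow> dist (x j) (y j) \<le> t"
  shows "real (card E) * (\<Prod>j\<in>UNIV. a j * h j powr \<delta> j) \<le> (\<Prod>j\<in>UNIV. b j * (2 * t) powr \<delta> j)"
proof (cases "E = {}")
  case True
  then show ?thesis using pos by (auto intro!: prod_nonneg mult_nonneg_nonneg intro: less_imp_le)
next
  case False
  then obtain c where c: "c \<in> E" by blast
  interpret R: ahlfors_regular "m j" "\<Omega>s j" "\<delta> j" "a j" "b j" for j by (rule regular)
  interpret P: finite_product_sigma_finite m UNIV
    by (simp add: finite_product_sigma_finite_def finite_product_sigma_finite_axioms_def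
        product_sigma_finite_def R.sigma_finite_measure_axioms)
  let ?P = "PiM UNIV m"
  have box_sets: "PiE UNIV B \<in> sets ?P" if "\<And>j. open (B j)" for B
    using that by (intro sets_PiM_I_finite) (simp_all add: R.sets_eq)
  have box: "emeasure ?P (PiE UNIV B) = ennreal (\<Prod>j\<in>UNIV. measure (m j) (B j))"
    if "\<And>j. open (B j)" for B
    using that by (subst P.measure_times) (simp_all add: R.sets_eq R.emeasure_eq_measure prod_ennreal)
  interpret F: finite_measure ?P
  proof
    have "emeasure ?P (PiE UNIV (\<lambda>_. UNIV)) \<noteq> \<infinity>" by (subst box) auto
    then show "emeasure ?P (space ?P) \<noteq> \<infinity>" by (simp add: space_PiM R.space_eq)
  qed
  let ?B = "\<lambda>x. PiE UNIV (\<lambda>j. ball (x j) (h j))" and ?V = "PiE UNIV (\<lambda>j. ball (c j) (2 * t))"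
  have box_measure: "measure ?P (PiE UNIV B) = (\<Prod>j\<in>UNIV. measure (m j) (B j))"
    if "\<And>j. open (B j)" for B
    using box[OF that] by (simp add: measure_def prod_nonneg)
  have "real (card E) * (\<Prod>j\<in>UNIV. a j * h j powr \<delta> j) \<le> measure ?P ?V"
  proof (rule F.card_disjoint_family_le)
    have "?B x \<inter> ?B y = {}" if "x \<in> E" "y \<in> E" "x \<noteq> y" for x y
    proof -
      from pairwiseD[OF sep that] obtain j where "2 * h j < dist (x j) (y j)" by blast
      then have "ball (x j) (h j) \<inter> ball (y j) (h j) = {}" by (intro disjoint_ballI) simp
      then show ?thesis by (force simp: PiE_iff)
    qed
    then show "disjoint_family_on ?B E" by (auto simp: disjoint_family_on_def)
    show "?B x \<subseteq> ?V" if "x \<in> E" for x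
    proof (rule PiE_mono)
      fix j
      show "ball (x j) (h j) \<subseteq> ball (c j) (2 * t)"
        using diam[OF c that, of j] assms(5)[of j]
        by (smt (verit) mem_ball dist_triangle subsetI)
    qed
    show "(\<Prod>j\<in>UNIV. a j * h j powr \<delta> j) \<le> measure ?P (?B x)" if "x \<in> E" for x
      using assms that pos
      by (subst box_measure) (auto intro!: prod_mono R.lower simp: less_imp_le)
  qed (auto intro!: box_sets assms)
  also have "\<dots> \<le> (\<Prod>j\<in>UNIV. b j * (2 * t) powr \<delta> j)"
    using c assms(2) less_le_trans[OF assms(3,5)]
    by (subst box_measure) (auto intro!: prod_mono R.upper)
  finally show ?thesis .
qed

end

subsection \<open>Trees of boxes\<close>

text \<open>Nested boxes given by centre and radii: a box of generation \<open>n\<close> has radii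
  \<open>\<rho> n j\<close>, and its \<open>M\<close> children have the centres
  \<open>child n x k\<close>. \<open>child_near\<close> puts each child box inside its parent,
  \<open>child_sep\<close> makes sibling boxes disjoint. The number \<open>M\<close> is the same at
  every node, so that uniform choices yield equal masses.\<close>

locale box_tree = ahlfors_regular_family m \<Omega>s \<delta> a b
  for m :: "'n::finite \<Rightarrow> 'a::complete_space measure" and \<Omega>s \<delta> a b +
  fixes \<rho> :: "nat \<Rightarrow> 'n \<Rightarrow> real" and x0 :: "'n \<Rightarrow> 'a"
    and child :: "nat \<Rightarrow> ('n \<Rightarrow> 'a) \<Rightarrow> nat \<Rightarrow> 'n \<Rightarrow> 'a" and M :: nat
  assumes M_pos: "0 < M"
    and rad_pos: "\<And>n j. 0 < \<rho> n j" and rad_le_1: "\<And>n j. \<rho> n j \<le> 1"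
    and rad_tendsto: "\<And>j. (\<lambda>n. \<rho> n j) \<longlonglongrightarrow> 0"
    and root: "\<And>j. x0 j \<in> \<Omega>s j"
    and child_in: "\<And>x n k j. (\<And>j. x j \<in> \<Omega>s j) \<Longrightarrow> k < M \<Longrightarrow> child n x k j \<in> \<Omega>s j"
    and child_near: "\<And>x n k j. (\<And>j. x j \<in> \<Omega>s j) \<Longrightarrow> k < M \<Longrightarrow>
      dist (x j) (child n x k j) \<le> \<rho> n j - \<rho> (Suc n) j"
    and child_sep: "\<And>x n k l. (\<And>j. x j \<in> \<Omega>s j) \<Longrightarrow> k < M \<Longrightarrow> l < M \<Longrightarrow> k \<noteq> l \<Longrightarrow>
      \<exists>j. 2 * \<rho> (Suc n) j < dist (child n x k j) (child n x l j)"
begin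

primrec node :: "(nat \<Rightarrow> nat) \<Rightarrow> nat \<Rightarrow> 'n \<Rightarrow> 'a" where
  "node \<omega> 0 = x0"
| "node \<omega> (Suc n) = child n (node \<omega> n) (\<omega> n)"

definition limit_point :: "(nat \<Rightarrow> nat) \<Rightarrow> 'n \<Rightarrow> 'a" where
  "limit_point \<omega> j = lim (\<lambda>n. node \<omega> n j)"

text \<open>Independent uniform choices of the next child; each prefix of length \<open>n\<close>
  has mass \<open>1 / M ^ n\<close>. The Cantor measure is the law of \<open>limit_point\<close>
  under this measure.\<close>

definition branches :: "(nat \<Rightarrow> nat) measure" where
  "branches = PiM UNIV (\<lambda>_. uniform_count_measure {..<M})"

lemma prob_space_branches: "prob_space branches"
  unfolding branches_def using M_pos
  by (intro prob_space_PiM prob_space_uniform_count_measure) auto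

lemma space_branches: "\<omega> \<in> space branches \<longleftrightarrow> (\<forall>k. \<omega> k < M)"
  by (auto simp: branches_def space_PiM space_uniform_count_measure PiE_iff)

lemma node_in:
  assumes "\<omega> \<in> space branches"
  shows "node \<omega> n j \<in> \<Omega>s j"
  by (induction n arbitrary: j) (use assms in \<open>auto intro!: root child_in simp: space_branches\<close>)

text \<open>The increments allowed by \<open>child_near\<close> telescope.\<close>

lemma node_near:
  assumes "\<omega> \<in> space branches" "n \<le> n'"
  shows "dist (node \<omega> n j) (node \<omega> n' j) \<le> \<rho> n j - \<rho> n' j"
  using assms(2)
proof (induction n' rule: dec_induct)
  case (step n')
  have "dist (node \<omega> n' j) (node \<omega> (Suc n') j) \<le> \<rho> n' j - \<rho> (Suc n') j"
    using assms(1) node_in[OF assms(1)]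
      child_near[where x = "node \<omega> n'" and n = n' and k = "\<omega> n'" and j = j] by (simp add: space_branches)
  then show ?case using step.IH dist_triangle[of "node \<omega> n j" "node \<omega> (Suc n') j" "node \<omega> n' j"]
    by linarith
qed simp

lemma node_tendsto:
  assumes "\<omega> \<in> space branches"
  shows "(\<lambda>n. node \<omega> n j) \<longlonglongrightarrow> limit_point \<omega> j"
proof -
  have "Cauchy (\<lambda>n. node \<omega> n j)"
  proof (rule metric_CauchyI)
    fix e :: real assume "0 < e"
    then obtain n0 where n0: "\<And>n. n \<ge> n0 \<Longrightarrow> \<rho> n j < e / 2"
      using order_tendstoD(2)[OF rad_tendsto[of j], of "e / 2"] by (auto simp: eventually_sequentially)
    have "dist (node \<omega> n j) (node \<omega> n' j) < e" if "n0 \<le> n" "n0 \<le> n'" for n n'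
      using node_near[OF assms that(1), of j] node_near[OF assms that(2), of j] n0[of n0]
        rad_pos[of n j] rad_pos[of n' j] dist_triangle3[of "node \<omega> n j" "node \<omega> n' j" "node \<omega> n0 j"]
      by simp
    then show "\<exists>N. \<forall>n\<ge>N. \<forall>n'\<ge>N. dist (node \<omega> n j) (node \<omega> n' j) < e" by blast
  qed
  then show ?thesis
    unfolding limit_point_def by (simp add: Cauchy_convergent_iff convergent_LIMSEQ_iff)
qed

lemma limit_point_near:
  assumes "\<omega> \<in> space branches"
  shows "dist (node \<omega> n j) (limit_point \<omega> j) \<le> \<rho> n j"
proof (rule tendsto_upperbound)
  show "((\<lambda>n'. dist (node \<omega> n j) (node \<omega> n' j)) \<longlongrightarrow> dist (node \<omega> n j) (limit_point \<omega> j)) sequentially"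
    by (intro tendsto_dist tendsto_const node_tendsto assms)
  show "\<forall>\<^sub>F n' in sequentially. dist (node \<omega> n j) (node \<omega> n' j) \<le> \<rho> n j"
    using eventually_ge_at_top[of n]
  proof eventually_elim
    case (elim n')
    then show ?case using node_near[OF assms elim, of j] rad_pos[of n' j] by linarith
  qed
qed simp

lemma limit_point_in:
  assumes "\<omega> \<in> space branches"
  shows "limit_point \<omega> j \<in> \<Omega>s j"
  using regular[of j] node_tendsto[OF assms] node_in[OF assms]
  by (meson ahlfors_regular.closed closed_sequentially)

text \<open>If the branches part before the last step, their boxes are disjoint one generation
  earlier and the children stay inside; otherwise both nodes have the same parent and
  \<open>child_sep\<close> applies.\<close>

lemma node_sep:
  assumes "\<omega> \<in> space branches" "\<omega>' \<in> space branches" "k < n" "\<omega> k \<noteq> \<omega>' k"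
  shows "\<exists>j. 2 * \<rho> n j < dist (node \<omega> n j) (node \<omega>' n j)"
  using assms(3,4)
proof (induction n arbitrary: k)
  case (Suc n)
  show ?case
  proof (cases "\<exists>l<n. \<omega> l \<noteq> \<omega>' l")
    case True
    then obtain j where "2 * \<rho> n j < dist (node \<omega> n j) (node \<omega>' n j)" using Suc.IH by blast
    moreover have "dist (node \<omega> n j) (node \<omega> (Suc n) j) \<le> \<rho> n j - \<rho> (Suc n) j"
      "dist (node \<omega>' n j) (node \<omega>' (Suc n) j) \<le> \<rho> n j - \<rho> (Suc n) j"
      using node_near[OF assms(1), of n "Suc n"] node_near[OF assms(2), of n "Suc n"] by simp_all
    ultimately have "2 * \<rho> (Suc n) j < dist (node \<omega> (Suc n) j) (node \<omega>' (Suc n) j)"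
      using dist_triangle[of "node \<omega> n j" "node \<omega>' n j" "node \<omega> (Suc n) j"]
        dist_triangle2[of "node \<omega> (Suc n) j" "node \<omega>' n j" "node \<omega>' (Suc n) j"] by linarith
    then show ?thesis by blast
  next
    case False
    have "node \<omega> l = node \<omega>' l" if "l \<le> n" for l using that False by (induction l) auto
    moreover have "\<omega> n \<noteq> \<omega>' n" using False Suc.prems by (metis less_SucE)
    ultimately show ?thesis
      using child_sep[where x = "node \<omega>' n" and n = n and k = "\<omega> n" and l = "\<omega>' n"] assms(1,2)
        node_in[OF assms(2)]
      by (simp add: space_branches)
  qed
qed simp

text \<open>The union of the cylinders over \<open>W\<close> is a measurable superset, and each
  cylinder has mass \<open>(1 / M) ^ n\<close>.\<close>

lemma measure_branches_le:
  assumes "finite W" "W \<subseteq> PiE {..<n} (\<lambda>_. {..<M})"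
  shows "\<exists>A\<in>sets branches. {\<omega>\<in>space branches. restrict \<omega> {..<n} \<in> W} \<subseteq> A \<and>
    measure branches A \<le> card W / real M ^ n"
proof -
  let ?u = "uniform_count_measure {..<M}"
  interpret u: prob_space ?u
    using M_pos by (intro prob_space_uniform_count_measure) auto
  interpret P: product_prob_space "\<lambda>_::nat. ?u" UNIV
    by (simp add: product_prob_space_def product_prob_space_axioms_def product_sigma_finite_def
        u.prob_space_axioms u.sigma_finite_measure_axioms)
  interpret B: prob_space branches by (rule prob_space_branches)
  define cyl where "cyl = (\<lambda>w. prod_emb UNIV (\<lambda>_::nat. ?u) {..<n} (PiE {..<n} (\<lambda>k. {w k})))"
  have cyl: "cyl w \<in> sets branches" "emeasure branches (cyl w) = ennreal ((1 / real M) ^ n)"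
    if "w \<in> W" for w
  proof -
    have w: "w k < M" if "k < n" for k using \<open>w \<in> W\<close> assms(2) that by (auto simp: PiE_iff subset_iff)
    show "cyl w \<in> sets branches"
      unfolding cyl_def branches_def using w by (intro sets_PiM_I) auto
    have "emeasure branches (cyl w) = (\<Prod>k<n. emeasure ?u {w k})"
      unfolding cyl_def branches_def using w by (intro P.emeasure_PiM_emb) auto
    also have "\<dots> = (\<Prod>k<n. ennreal (1 / real M))"
      using w by (intro prod.cong) (auto simp: emeasure_uniform_count_measure)
    finally show "emeasure branches (cyl w) = ennreal ((1 / real M) ^ n)"
      by (simp add: ennreal_power)
  qed
  have "{\<omega>\<in>space branches. restrict \<omega> {..<n} \<in> W} \<subseteq> (\<Union>w\<in>W. cyl w)"
  proof safe
    fix \<omega> assume "\<omega> \<in> space branches" "restrict \<omega> {..<n} \<in> W"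
    then show "\<omega> \<in> (\<Union>w\<in>W. cyl w)"
      by (intro UN_I[of "restrict \<omega> {..<n}"]) (auto simp: cyl_def prod_emb_def space_branches space_uniform_count_measure PiE_iff)
  qed
  moreover have "measure branches (\<Union>w\<in>W. cyl w) \<le> (\<Sum>w\<in>W. measure branches (cyl w))"
    using cyl assms by (intro B.finite_measure_subadditive_finite) auto
  moreover have "(\<Sum>w\<in>W. measure branches (cyl w)) = (\<Sum>w\<in>W. (1 / real M) ^ n)"
    using cyl by (intro sum.cong refl) (simp add: measure_def)
  moreover have "(\<Union>w\<in>W. cyl w) \<in> sets branches" using cyl assms by auto
  ultimately show ?thesis by (intro bexI[of _ "\<Union>w\<in>W. cyl w"]) (auto simp: power_divide)
qed

text \<open>Prefixes of branches ending in \<open>U\<close> are counted by their nodes of generation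
  \<open>n\<close>: these have disjoint boxes and lie close together, so the packing bound for boxes
  limits their number.\<close>

lemma measure_limit_points_le:
  assumes U: "\<And>x y j. x \<in> U \<Longrightarrow> y \<in> U \<Longrightarrow> dist (x j) (y j) \<le> r" and r: "\<And>j. \<rho> n j \<le> r"
  shows "\<exists>A\<in>sets branches. {\<omega>\<in>space branches. limit_point \<omega> \<in> U} \<subseteq> A \<and>
    measure branches A * (real M ^ n * (\<Prod>j\<in>UNIV. a j * \<rho> n j powr \<delta> j))
      \<le> (\<Prod>j\<in>UNIV. b j * (6 * r) powr \<delta> j)"
proof -
  define \<Psi> where "\<Psi> = {\<omega>\<in>space branches. limit_point \<omega> \<in> U}"
  define W where "W = (\<lambda>\<omega>. restrict \<omega> {..<n}) ` \<Psi>"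
  have W_sub: "W \<subseteq> PiE {..<n} (\<lambda>_. {..<M})" by (auto simp: W_def \<Psi>_def space_branches PiE_iff split: if_splits)
  then have "finite W" by (rule finite_subset) (auto intro: finite_PiE)
  have "\<forall>w\<in>W. \<exists>\<omega>. \<omega> \<in> \<Psi> \<and> restrict \<omega> {..<n} = w" by (auto simp: W_def)
  from bchoice[OF this] obtain ext where ext: "\<And>w. w \<in> W \<Longrightarrow> ext w \<in> \<Psi>"
    "\<And>w. w \<in> W \<Longrightarrow> restrict (ext w) {..<n} = w" by blast
  have ext_branch: "ext w \<in> space branches" if "w \<in> W" for w
    using ext(1)[OF that] by (auto simp: \<Psi>_def)
  define E where "E = (\<lambda>w. node (ext w) n) ` W"
  have sep: "\<exists>j. 2 * \<rho> n j < dist (node (ext w) n j) (node (ext v) n j)"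
    if "w \<in> W" "v \<in> W" "w \<noteq> v" for w v
  proof -
    have "restrict (ext w) {..<n} \<noteq> restrict (ext v) {..<n}" using ext(2) that by simp
    then obtain k where "k < n" "ext w k \<noteq> ext v k" by (auto simp: restrict_def fun_eq_iff split: if_splits)
    then show ?thesis using node_sep ext_branch that by blast
  qed
  have "inj_on (\<lambda>w. node (ext w) n) W"
    using sep rad_pos by (intro inj_onI) (smt (verit) dist_self)
  then have card_E: "card E = card W" by (simp add: E_def card_image)
  \<comment> \<open>Nodes are within \<open>r\<close> of their limit points, which are at most
    \<open>r\<close> apart: hence the diameter \<open>3 * r\<close>, doubled by the packing bound to
    give the 6.\<close>
  have card_E_le: "real (card E) * (\<Prod>j\<in>UNIV. a j * \<rho> n j powr \<delta> j) \<le> (\<Prod>j\<in>UNIV. b j * (2 * (3 * r)) powr \<delta> j)"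
  proof (rule card_box_separated_le)
    show "finite E" using \<open>finite W\<close> by (simp add: E_def)
    show "x j \<in> \<Omega>s j" if "x \<in> E" for x j using that node_in ext_branch by (auto simp: E_def)
    show "\<rho> n j \<le> 3 * r" for j using r[of j] rad_pos[of n j] by linarith
    show "pairwise (\<lambda>x y. \<exists>j. 2 * \<rho> n j < dist (x j) (y j)) E"
      using sep by (fastforce simp: pairwise_def E_def)
    show "dist (x j) (y j) \<le> 3 * r" if xy: "x \<in> E" "y \<in> E" for x y j
    proof -
      from xy obtain w v where wv: "w \<in> W" "v \<in> W" "x = node (ext w) n" "y = node (ext v) n"
        by (auto simp: E_def)
      let ?p = "limit_point (ext w) j" and ?q = "limit_point (ext v) j"
      have "dist (x j) ?p \<le> \<rho> n j" "dist (y j) ?q \<le> \<rho> n j"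
        using wv limit_point_near ext_branch by auto
      moreover have "dist ?p ?q \<le> r" using U ext(1) wv by (simp add: \<Psi>_def)
      ultimately show ?thesis using r[of j]
          dist_triangle[of "x j" "y j" ?p] dist_triangle[of ?p "y j" ?q] by (simp add: dist_commute)
    qed
  qed (auto intro: rad_pos rad_le_1)
  obtain A where A: "A \<in> sets branches" "{\<omega>\<in>space branches. restrict \<omega> {..<n} \<in> W} \<subseteq> A"
    "measure branches A \<le> card W / real M ^ n"
    using measure_branches_le[OF \<open>finite W\<close> W_sub] by blast
  have "measure branches A * (real M ^ n * (\<Prod>j\<in>UNIV. a j * \<rho> n j powr \<delta> j))
      \<le> card W / real M ^ n * (real M ^ n * (\<Prod>j\<in>UNIV. a j * \<rho> n j powr \<delta> j))"
    using A(3) pos by (intro mult_right_mono) (auto intro!: prod_nonneg mult_nonneg_nonneg simp: less_imp_le)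
  also have "\<dots> = real (card E) * (\<Prod>j\<in>UNIV. a j * \<rho> n j powr \<delta> j)" using M_pos by (simp add: card_E)
  also note card_E_le
  finally have "measure branches A * (real M ^ n * (\<Prod>j\<in>UNIV. a j * \<rho> n j powr \<delta> j))
      \<le> (\<Prod>j\<in>UNIV. b j * (6 * r) powr \<delta> j)" by simp
  moreover have "{\<omega>\<in>space branches. limit_point \<omega> \<in> U} \<subseteq> A"
    using A(2) by (auto simp: W_def \<Psi>_def)
  ultimately show ?thesis using A(1) by (intro bexI[of _ A]) auto
qed

end

subsection \<open>Gaussian integers\<close>

lemma gaussian_ints_closed:
  assumes "z \<in> gaussian_ints" "w \<in> gaussian_ints"
  shows "z + w \<in> gaussian_ints" "z - w \<in> gaussian_ints" "z * w \<in> gaussian_ints"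
  using assms by (auto simp: gaussian_ints_def)

lemma gaussian_ints_sum: "(\<And>x. x \<in> A \<Longrightarrow> f x \<in> gaussian_ints) \<Longrightarrow> sum f A \<in> gaussian_ints"
  by (auto simp: gaussian_ints_def)

lemma gaussian_ints_norm_less_1:
  assumes "z \<in> gaussian_ints" "cmod z < 1"
  shows "z = 0"
proof -
  have "\<bar>Re z\<bar> < 1" "\<bar>Im z\<bar> < 1"
    using assms(2) abs_Re_le_cmod[of z] abs_Im_le_cmod[of z] by linarith+
  then show ?thesis
    using assms(1) by (auto simp: gaussian_ints_def complex_eq_iff Ints_def)
qed

text \<open>Dirichlet's pigeonhole argument over the Gaussian integers. Coefficients with real and
  imaginary parts in \<open>{..K s}\<close> give the square of
  \<open>\<Prod>s\<in>S. K s + 1\<close> vectors, more than the \<open>L\<close> times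
  \<open>L\<close> cells into which the fractional parts of the form fall. Two vectors sharing a
  cell differ by \<open>\<alpha>\<close>, and \<open>\<beta>\<close> cancels the difference of the
  integer parts.\<close>

lemma gaussian_dirichlet:
  fixes x :: "'n \<Rightarrow> complex" and K :: "'n \<Rightarrow> nat" and L :: nat
  assumes "finite S" "0 < L" and L: "L < (\<Prod>s\<in>S. K s + 1)"
  obtains \<alpha> \<beta> where "\<And>s. s \<in> S \<Longrightarrow> \<alpha> s \<in> gaussian_ints" "\<beta> \<in> gaussian_ints"
    "\<exists>s\<in>S. \<alpha> s \<noteq> 0" "\<And>s. s \<in> S \<Longrightarrow> cmod (\<alpha> s) \<le> 2 * K s"
    "cmod ((\<Sum>s\<in>S. \<alpha> s * x s) + \<beta>) \<le> 2 / L"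
proof -
  define G where "G = (\<lambda>s. {..K s} \<times> {..K s})"
  define F where "F = (\<lambda>u::'n \<Rightarrow> nat \<times> nat. \<Sum>s\<in>S. Complex (real (fst (u s))) (real (snd (u s))) * x s)"
  define cell where "cell = (\<lambda>u. (nat \<lfloor>L * frac (Re (F u))\<rfloor>, nat \<lfloor>L * frac (Im (F u))\<rfloor>))"
  have cell_less: "nat \<lfloor>L * frac y\<rfloor> < L" for y :: real
    using \<open>0 < L\<close> frac_lt_1[of y] frac_ge_0[of y]
    by (simp add: nat_less_iff floor_less_iff)
  have close: "\<bar>frac y - frac y'\<bar> \<le> 1 / L" if "nat \<lfloor>L * frac y\<rfloor> = nat \<lfloor>L * frac y'\<rfloor>" for y y' :: real
  proof -
    have "\<lfloor>L * frac y\<rfloor> = \<lfloor>L * frac y'\<rfloor>" using that frac_ge_0[of y] frac_ge_0[of y'] \<open>0 < L\<close>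
      by (simp add: nat_eq_iff split: if_splits)
    then have "\<bar>L * frac y - L * frac y'\<bar> \<le> 1" by linarith
    moreover have "\<bar>L * frac y - L * frac y'\<bar> = L * \<bar>frac y - frac y'\<bar>"
      by (simp add: abs_mult flip: right_diff_distrib)
    ultimately show ?thesis using \<open>0 < L\<close> by (simp add: field_simps)
  qed
  have "card (cell ` PiE S G) \<le> card ({..<L} \<times> {..<L})"
    using cell_less by (intro card_mono) (auto simp: cell_def)
  also have "\<dots> < card (PiE S G)"
    using mult_strict_mono[OF L L] assms by (simp add: G_def card_PiE card_cartesian_product prod.distrib
      del: mult_Suc mult_Suc_right)
  finally have "\<not> inj_on cell (PiE S G)" by (rule pigeonhole)
  then obtain u v where uv: "u \<in> PiE S G" "v \<in> PiE S G" "u \<noteq> v" "cell u = cell v"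
    by (auto simp: inj_on_def)
  define \<alpha> where "\<alpha> = (\<lambda>s. Complex (real (fst (u s)) - fst (v s)) (real (snd (u s)) - snd (v s)))"
  define \<beta> where "\<beta> = Complex (of_int \<lfloor>Re (F v)\<rfloor> - of_int \<lfloor>Re (F u)\<rfloor>) (of_int \<lfloor>Im (F v)\<rfloor> - of_int \<lfloor>Im (F u)\<rfloor>)"
  show thesis
  proof (rule that)
    show "\<alpha> s \<in> gaussian_ints" for s by (simp add: \<alpha>_def gaussian_ints_def)
    show "\<beta> \<in> gaussian_ints" by (simp add: \<beta>_def gaussian_ints_def)
    obtain s where s: "s \<in> S" "u s \<noteq> v s" using uv(1-3) by (metis PiE_ext)
    then have "\<alpha> s \<noteq> 0" by (auto simp: \<alpha>_def complex_eq_iff prod_eq_iff)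
    with s show "\<exists>s\<in>S. \<alpha> s \<noteq> 0" by blast
    \<comment> \<open>The factors 2 here and in \<open>2 / L\<close> come from bounding the modulus
      by the sum of the absolute real and imaginary parts.\<close>
    show "cmod (\<alpha> s) \<le> 2 * K s" if "s \<in> S" for s
    proof -
      have "u s \<in> G s" "v s \<in> G s" using uv(1,2) that by auto
      then have "\<bar>Re (\<alpha> s)\<bar> \<le> K s" "\<bar>Im (\<alpha> s)\<bar> \<le> K s" by (auto simp: \<alpha>_def G_def)
      then show ?thesis using cmod_le[of "\<alpha> s"] by linarith
    qed
    have "(\<Sum>s\<in>S. \<alpha> s * x s) = F u - F v"
      by (simp add: F_def \<alpha>_def left_diff_distrib flip: sum_subtractf complex_diff)
    then have "(\<Sum>s\<in>S. \<alpha> s * x s) + \<beta> = Complex (frac (Re (F u)) - frac (Re (F v))) (frac (Im (F u)) - frac (Im (F v)))"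
      by (simp add: \<beta>_def complex_eq_iff frac_def)
    moreover have "\<bar>frac (Re (F u)) - frac (Re (F v))\<bar> \<le> 1 / L" "\<bar>frac (Im (F u)) - frac (Im (F v))\<bar> \<le> 1 / L"
      using uv(4) by (auto simp: cell_def intro!: close)
    ultimately show "cmod ((\<Sum>s\<in>S. \<alpha> s * x s) + \<beta>) \<le> 2 / L"
      using cmod_le[of "(\<Sum>s\<in>S. \<alpha> s * x s) + \<beta>"] by simp
  qed
qed

subsection \<open>Boxes and rational points\<close>

text \<open>With \<open>R ^ n\<close> in the role of \<open>cmod q\<close>, the exponent
  \<open>1 + i j\<close> is the one that bad approximability prescribes for the distance from
  \<open>z j\<close> to \<open>p j / q\<close>. The denominator comes from the error budget of
  \<open>rationals_in_box_on_hyperplane\<close>.\<close>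

definition box_radius :: "('n::finite \<Rightarrow> real) \<Rightarrow> real \<Rightarrow> nat \<Rightarrow> 'n \<Rightarrow> real" where
  "box_radius i R n j = R powr (- (real n * (1 + i j))) / (40 * real CARD('n) * R\<^sup>2)"

lemma box_radius_pos: "0 < R \<Longrightarrow> 0 < box_radius i R n j"
  by (simp add: box_radius_def)

lemma box_radius_Suc:
  "0 < R \<Longrightarrow> box_radius i R (Suc n) j = box_radius i R n j / R powr (1 + i j)"
  by (simp add: box_radius_def algebra_simps powr_diff powr_add powr_minus divide_simps)

lemma box_radius_Suc_le:
  assumes "1 \<le> R" "0 \<le> i j"
  shows "R * box_radius i R (Suc n) j \<le> box_radius i R n j"
proof -
  have "R powr 1 \<le> R powr (1 + i j)" using assms by (intro powr_mono) auto
  then show ?thesis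
    using assms box_radius_pos[of R i n j] by (simp add: box_radius_Suc divide_simps mult.commute)
qed

lemma box_radius_le:
  fixes i :: "'n::finite \<Rightarrow> real"
  assumes "1 \<le> R" "0 \<le> i j"
  shows "box_radius i R n j \<le> 1 / R ^ n"
proof -
  have "R powr (- (real n * (1 + i j))) \<le> R powr (- real n)"
    using assms by (intro powr_mono) (auto simp: algebra_simps)
  also have "\<dots> = 1 / R ^ n" using assms by (simp add: powr_minus powr_realpow divide_simps)
  finally have num: "R powr (- (real n * (1 + i j))) \<le> 1 / R ^ n" .
  have "1 * 1 \<le> (40 * real CARD('n)) * R\<^sup>2"
    using assms zero_less_card_finite[where 'a = 'n] by (intro mult_mono one_le_power) linarith+
  then have "box_radius i R n j \<le> R powr (- (real n * (1 + i j))) / 1"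
    unfolding box_radius_def by (intro divide_left_mono) auto
  then show ?thesis using num by simp
qed

text \<open>At all such \<open>p / q\<close> the Dirichlet form for the centre \<open>x\<close> is
  smaller than \<open>1 / R ^ Suc n\<close>: half of this bound pays for its value at
  \<open>x\<close> and half for moving from \<open>x\<close> to \<open>p / q\<close>. Multiplied by
  \<open>q\<close> it is a Gaussian integer of modulus below 1, hence 0.\<close>

lemma rationals_in_box_on_hyperplane:
  fixes i :: "'n::finite \<Rightarrow> real" and x :: "'n \<Rightarrow> complex"
  assumes i_nonneg: "\<And>j. 0 \<le> i j" and i_sum: "(\<Sum>j\<in>UNIV. i j) = 1" and R: "1 \<le> R"
  obtains \<alpha> \<beta> where "\<exists>s\<in>{s. 0 < i s}. \<alpha> s \<noteq> 0"
    "\<And>q p. q \<in> gaussian_ints \<Longrightarrow> q \<noteq> 0 \<Longrightarrow> cmod q < R ^ Suc n \<Longrightarrow> (\<And>s. p s \<in> gaussian_ints) \<Longrightarrow>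
      (\<And>s. 0 < i s \<Longrightarrow> cmod (p s / q - x s) \<le> 2 * box_radius i R n s) \<Longrightarrow>
      (\<Sum>s | 0 < i s. \<alpha> s * (p s / q)) + \<beta> = 0"
proof -
  define S where "S = {s. 0 < i s}"
  \<comment> \<open>Since the \<open>i s\<close> sum to 1, these bounds have product at least
    \<open>5 * R ^ Suc n\<close>, hence at least \<open>L\<close>; the 5 leaves room for the
    rounding in \<open>L\<close>.\<close>
  define T where "T = (\<lambda>s. 5 * R * R powr (n * i s))"
  define K where "K = (\<lambda>s. nat \<lfloor>T s\<rfloor>)"
  \<comment> \<open>\<open>L\<close> exceeds \<open>4 * R ^ Suc n\<close>, so that
    \<open>2 / L\<close> is below half of \<open>1 / R ^ Suc n\<close>.\<close>
  define L where "L = nat \<lfloor>4 * R ^ Suc n\<rfloor> + 1"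
  let ?N = "real CARD('n)"
  have "1 \<le> R ^ Suc n" using R by (rule one_le_power)
  have L: "4 * R ^ Suc n < L" "L \<le> 5 * R ^ Suc n"
    using \<open>1 \<le> R ^ Suc n\<close> unfolding L_def by linarith+
  have T_pos: "0 < T s" for s using R by (simp add: T_def)
  have K: "K s \<le> T s" "T s < real (K s) + 1" for s
    using T_pos[of s] unfolding K_def by linarith+
  have sum_S: "(\<Sum>s\<in>S. i s) = 1"
    using i_nonneg i_sum unfolding S_def
    by (subst sum.mono_neutral_left[of UNIV]) (auto simp: not_less intro: antisym)
  then have "S \<noteq> {}" by auto
  then obtain s1 where "s1 \<in> S" by blast
  have "real L \<le> 5 * R * R ^ n" using L by simp
  also have "\<dots> \<le> (5 * R) ^ card S * R ^ n"
    using R \<open>S \<noteq> {}\<close> by (intro mult_right_mono self_le_power) (auto simp: card_gt_0_iff)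
  also have "R ^ n = R powr (\<Sum>s\<in>S. n * i s)"
    using R by (simp add: sum_S powr_realpow flip: sum_distrib_left)
  also have "(5 * R) ^ card S * R powr (\<Sum>s\<in>S. n * i s) = (\<Prod>s\<in>S. T s)"
    using R by (simp add: T_def prod.distrib powr_sum)
  also have "\<dots> < (\<Prod>s\<in>S. real (K s) + 1)"
    using T_pos K \<open>s1 \<in> S\<close> by (intro prod_mono_strict[of s1]) (auto simp: less_imp_le)
  also have "\<dots> = real (\<Prod>s\<in>S. K s + 1)" by (simp add: add.commute)
  finally have "L < (\<Prod>s\<in>S. K s + 1)" by linarith
  then obtain \<alpha> \<beta> where \<alpha>\<beta>: "\<And>s. s \<in> S \<Longrightarrow> \<alpha> s \<in> gaussian_ints" "\<beta> \<in> gaussian_ints"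
    "\<exists>s\<in>S. \<alpha> s \<noteq> 0" "\<And>s. s \<in> S \<Longrightarrow> cmod (\<alpha> s) \<le> 2 * K s"
    "cmod ((\<Sum>s\<in>S. \<alpha> s * x s) + \<beta>) \<le> 2 / L"
    by (rule gaussian_dirichlet[of S L K x, rotated 2]) (auto simp: L_def)
  show thesis
  proof (rule that)
    show "\<exists>s\<in>{s. 0 < i s}. \<alpha> s \<noteq> 0" using \<alpha>\<beta>(3) by (simp add: S_def)
    fix q and p :: "'n \<Rightarrow> complex"
    assume q: "q \<in> gaussian_ints" "q \<noteq> 0" "cmod q < R ^ Suc n" and p: "\<And>s. p s \<in> gaussian_ints"
      and near: "\<And>s. 0 < i s \<Longrightarrow> cmod (p s / q - x s) \<le> 2 * box_radius i R n s"
    let ?v = "(\<Sum>s\<in>S. \<alpha> s * (p s / q)) + \<beta>"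
    have "q * ?v = (\<Sum>s\<in>S. \<alpha> s * p s) + q * \<beta>"
      using q(2) by (simp add: distrib_left sum_distrib_left)
    then have int: "q * ?v \<in> gaussian_ints"
      using \<alpha>\<beta>(1,2) q(1) p by (auto intro!: gaussian_ints_closed gaussian_ints_sum)
    \<comment> \<open>Here the constant 40 and the factor \<open>R\<^sup>2\<close> in
      \<open>box_radius\<close> are spent: there are at most \<open>CARD('n)\<close> summands, and
      together they use the other half.\<close>
    have summand: "cmod (\<alpha> s * (p s / q - x s)) \<le> 1 / (2 * ?N * R ^ Suc n)" if "s \<in> S" for s
    proof -
      have "cmod (\<alpha> s * (p s / q - x s)) \<le> (2 * T s) * (2 * box_radius i R n s)"
        unfolding norm_mult using that \<alpha>\<beta>(4)[OF that] K(1)[of s] near T_pos[of s]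
        by (intro mult_mono) (auto simp: S_def)
      also have "\<dots> = 1 / (2 * ?N * R ^ Suc n)"
        using R by (simp add: T_def box_radius_def algebra_simps powr_add powr_diff powr_minus powr_realpow
            power2_eq_square divide_simps)
      finally show ?thesis .
    qed
    have "?v = ((\<Sum>s\<in>S. \<alpha> s * x s) + \<beta>) + (\<Sum>s\<in>S. \<alpha> s * (p s / q - x s))"
      by (simp add: right_diff_distrib sum_subtractf)
    then have "cmod ?v \<le> cmod ((\<Sum>s\<in>S. \<alpha> s * x s) + \<beta>) + cmod (\<Sum>s\<in>S. \<alpha> s * (p s / q - x s))"
      by (metis norm_triangle_ineq)
    also have "cmod ((\<Sum>s\<in>S. \<alpha> s * x s) + \<beta>) < 1 / (2 * R ^ Suc n)"
    proof -
      have "2 / real L < 2 / (4 * R ^ Suc n)"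
        using L(1) \<open>1 \<le> R ^ Suc n\<close> by (intro divide_strict_left_mono) auto
      also have "\<dots> = 1 / (2 * R ^ Suc n)" by simp
      finally show ?thesis using \<alpha>\<beta>(5) by linarith
    qed
    also have "cmod (\<Sum>s\<in>S. \<alpha> s * (p s / q - x s)) \<le> real (card S) * (1 / (2 * ?N * R ^ Suc n))"
      using summand by (intro sum_norm_bound)
    also have "\<dots> \<le> ?N * (1 / (2 * ?N * R ^ Suc n))"
      using \<open>1 \<le> R ^ Suc n\<close> by (intro mult_right_mono) (auto intro: card_mono)
    also have "\<dots> = 1 / (2 * R ^ Suc n)" by simp
    finally have "cmod ?v < 1 / R ^ Suc n" using \<open>1 \<le> R ^ Suc n\<close> by (simp add: field_simps)
    then have "cmod (q * ?v) < R ^ Suc n * (1 / R ^ Suc n)"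
      unfolding norm_mult using q by (intro mult_strict_mono') auto
    also have "\<dots> = 1" using R by simp
    finally have "q * ?v = 0" using gaussian_ints_norm_less_1 int by blast
    then show "(\<Sum>s | 0 < i s. \<alpha> s * (p s / q)) + \<beta> = 0" using q(2) by (simp add: S_def)
  qed
qed

section \<open>Discarding the children near a hyperplane\<close>

lemma card_le_fibres:
  assumes "finite T" "finite A" "f ` A \<subseteq> T" "\<And>t. t \<in> T \<Longrightarrow> real (card {x \<in> A. f x = t}) \<le> B"
  shows "real (card A) \<le> real (card T) * B"
proof -
  have "A = (\<Union>t\<in>T. {x \<in> A. f x = t})" using assms(3) by blast
  then have "card A \<le> (\<Sum>t\<in>T. card {x \<in> A. f x = t})" using assms(1) by (metis card_UN_le)
  then have "real (card A) \<le> (\<Sum>t\<in>T. real (card {x \<in> A. f x = t}))" by (metis of_nat_mono of_nat_sum)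
  also have "\<dots> \<le> (\<Sum>t\<in>T. B)" by (intro sum_mono assms)
  finally show ?thesis by simp
qed

text \<open>The other coordinates being given, a point near a hyperplane has its \<open>s0\<close>-coordinate in a ball
  of radius comparable to \<open>h s0\<close>, where \<open>s0\<close> maximises \<open>cmod (\<alpha> s) * h s\<close>.\<close>
lemma card_near_hyperplane_le:
  fixes m :: "'n::finite \<Rightarrow> complex measure" and \<alpha> :: "'n \<Rightarrow> complex" and \<beta> :: complex
  assumes fam: "ahlfors_regular_family m \<Omega>s \<delta> a b"
    and Y: "\<And>j. finite (Y j)" "\<And>j. Y j \<subseteq> \<Omega>s j" "\<And>j. pairwise (\<lambda>x y. 2 * h j < dist x y) (Y j)"
    and h: "\<And>j. 0 < h j" "\<And>j. h j \<le> 1"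
    and \<alpha>: "\<exists>s\<in>S. \<alpha> s \<noteq> 0"
    and large: "\<And>s. s \<in> S \<Longrightarrow> 2 * (b s / a s * (8 * CARD('n)) powr \<delta> s) \<le> card (Y s)"
  defines "near \<equiv> {y \<in> PiE UNIV Y. cmod ((\<Sum>s\<in>S. \<alpha> s * y s) + \<beta>) \<le> (\<Sum>s\<in>S. cmod (\<alpha> s) * (2 * h s))}"
  shows "2 * card near \<le> (\<Prod>j\<in>UNIV. card (Y j))"
proof -
  interpret ahlfors_regular_family m \<Omega>s \<delta> a b by fact
  let ?N = "real CARD('n)"
  have "finite S" by simp
  obtain s0 where s0: "s0 \<in> S" and max: "\<And>s. s \<in> S \<Longrightarrow> cmod (\<alpha> s) * h s \<le> cmod (\<alpha> s0) * h s0"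
  proof -
    have "Max ((\<lambda>s. cmod (\<alpha> s) * h s) ` S) \<in> (\<lambda>s. cmod (\<alpha> s) * h s) ` S"
      using \<alpha> by (intro Max_in) auto
    then obtain s0 where "s0 \<in> S" "cmod (\<alpha> s0) * h s0 = Max ((\<lambda>s. cmod (\<alpha> s) * h s) ` S)" by auto
    then show ?thesis using that by simp
  qed
  have "\<alpha> s0 \<noteq> 0"
  proof
    assume "\<alpha> s0 = 0"
    then have "cmod (\<alpha> s) * h s \<le> 0" if "s \<in> S" for s using max[OF that] by simp
    then show False using \<alpha> h(1) by (metis mult_pos_pos not_le zero_less_norm_iff)
  qed
  have width: "(\<Sum>s\<in>S. cmod (\<alpha> s) * (2 * h s)) \<le> ?N * (2 * (cmod (\<alpha> s0) * h s0))"
  proof -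
    have "(\<Sum>s\<in>S. cmod (\<alpha> s) * (2 * h s)) \<le> (\<Sum>s\<in>S. 2 * (cmod (\<alpha> s0) * h s0))"
      using max by (intro sum_mono) (simp add: mult.left_commute)
    also have "\<dots> \<le> ?N * (2 * (cmod (\<alpha> s0) * h s0))"
      using less_imp_le[OF h(1)[of s0]] by (auto intro!: mult_right_mono card_mono)
    finally show ?thesis .
  qed
  \<comment> \<open>Bound for the number of points of \<open>near\<close> with all coordinates but
    \<open>s0\<close> prescribed; it does not depend on \<open>h\<close>.\<close>
  define B where "B = b s0 / a s0 * (8 * ?N) powr \<delta> s0"
  have "finite (PiE UNIV Y)" using Y(1) by (intro finite_PiE) auto
  then have fin: "finite near" by (rule rev_finite_subset) (auto simp: near_def)
  have "real (card near) \<le> real (card (PiE (UNIV - {s0}) Y)) * B"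
  proof (rule card_le_fibres[where f = "\<lambda>y. restrict y (UNIV - {s0})"])
    show "finite (PiE (UNIV - {s0}) Y)" using Y(1) by (intro finite_PiE) auto
    show "(\<lambda>y. restrict y (UNIV - {s0})) ` near \<subseteq> PiE (UNIV - {s0}) Y"
      by (auto simp: near_def PiE_iff split: if_splits)
    fix t assume "t \<in> PiE (UNIV - {s0}) Y"
    define F where "F = {y \<in> near. restrict y (UNIV - {s0}) = t}"
    have same: "y s = y' s" if "y \<in> F" "y' \<in> F" "s \<noteq> s0" for y y' s
    proof -
      have "restrict y (UNIV - {s0}) s = restrict y' (UNIV - {s0}) s" using that by (simp add: F_def)
      then show ?thesis using that(3) by simp
    qed
    have inj: "inj_on (\<lambda>y. y s0) F"
    proof (rule inj_onI)
      fix y y' assume "y \<in> F" "y' \<in> F" "y s0 = y' s0"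
      then show "y = y'" using same by (intro ext) metis
    qed
    let ?E = "(\<lambda>y. y s0) ` F"
    have sub: "?E \<subseteq> Y s0" by (auto simp: F_def near_def PiE_iff)
    \<comment> \<open>Points of a fibre differ only at \<open>s0\<close>, so the two values of the
      form differ by \<open>\<alpha> s0\<close> times the difference of these coordinates.\<close>
    have diam: "dist (y s0) (y' s0) \<le> 4 * ?N * h s0" if "y \<in> F" "y' \<in> F" for y y'
    proof -
      let ?f = "\<lambda>y. (\<Sum>s\<in>S. \<alpha> s * y s) + \<beta>"
      have "?f y - ?f y' = (\<Sum>s\<in>S. \<alpha> s * (y s - y' s))"
        by (simp add: right_diff_distrib sum_subtractf)
      also have "\<dots> = (\<Sum>s\<in>{s0}. \<alpha> s * (y s - y' s))"
        using s0 same[OF that] by (intro sum.mono_neutral_right) auto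
      finally have "cmod (\<alpha> s0) * dist (y s0) (y' s0) = cmod (?f y - ?f y')"
        by (simp add: norm_mult dist_norm)
      also have "\<dots> \<le> cmod (?f y) + cmod (?f y')" by (rule norm_triangle_ineq4)
      also have "\<dots> \<le> 2 * (?N * (2 * (cmod (\<alpha> s0) * h s0)))"
        using that width by (simp add: F_def near_def)
      also have "\<dots> = cmod (\<alpha> s0) * (4 * ?N * h s0)" by simp
      finally show ?thesis using \<open>\<alpha> s0 \<noteq> 0\<close> by simp
    qed
    interpret ahlfors_regular "m s0" "\<Omega>s s0" "\<delta> s0" "a s0" "b s0" by (rule regular)
    have "real (card ?E) * (a s0 * h s0 powr \<delta> s0) \<le> b s0 * (2 * (4 * ?N * h s0)) powr \<delta> s0"
    proof (rule card_separated_le)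
      have "1 \<le> 4 * ?N" using zero_less_card_finite[where 'a = 'n] by linarith
      then show "h s0 \<le> 4 * ?N * h s0" using h(1)[of s0] by simp
      show "finite ?E" using sub Y(1) finite_subset by blast
      show "?E \<subseteq> \<Omega>s s0" using sub Y(2) by blast
      show "pairwise (\<lambda>x y. 2 * h s0 < dist x y) ?E" using Y(3) sub by (rule pairwise_subset)
    qed (use h diam in auto)
    also have "\<dots> = B * (a s0 * h s0 powr \<delta> s0)"
      using h(1)[of s0] pos[of s0] by (simp add: B_def powr_mult)
    finally have "real (card ?E) \<le> B" using h(1)[of s0] pos(1)[of s0] by simp
    then show "real (card {y \<in> near. restrict y (UNIV - {s0}) = t}) \<le> B"
      using card_image[OF inj] by (simp add: F_def)
  qed (rule fin)
  also have "\<dots> = (\<Prod>j\<in>UNIV - {s0}. real (card (Y j))) * B" by (simp add: card_PiE)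
  \<comment> \<open>\<open>large\<close> says that \<open>B\<close> is at most half the number of
    points of \<open>Y s0\<close>.\<close>
  also have "2 * \<dots> \<le> (\<Prod>j\<in>UNIV - {s0}. real (card (Y j))) * card (Y s0)"
    using large[OF s0] mult_left_mono[of "2 * B" "card (Y s0)" "\<Prod>j\<in>UNIV - {s0}. real (card (Y j))"]
    by (simp add: B_def prod_nonneg mult_ac)
  also have "\<dots> = real (\<Prod>j\<in>UNIV. card (Y j))"
    by (simp add: prod.remove[of UNIV s0] mult.commute)
  finally show ?thesis by linarith
qed

text \<open>The candidates form the product of maximal separated sets in the coordinates, which
  \<open>card_cover_ge\<close> bounds from below; those near the hyperplane of the rational points,
  at most half, are removed. Each point of a remaining box then keeps its distance from every
  rational point with denominator below \<open>R ^ Suc n\<close>.\<close>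

lemma box_children:
  fixes m :: "'n::finite \<Rightarrow> complex measure"
  assumes fam: "ahlfors_regular_family m \<Omega>s \<delta> a b"
    and i_nonneg: "\<And>j. 0 \<le> i j" and i_sum: "(\<Sum>j\<in>UNIV. i j) = 1" and R: "4 \<le> R"
    and large: "\<And>s. 0 < i s \<Longrightarrow>
      2 * (b s / a s * (8 * CARD('n)) powr \<delta> s) \<le> a s / (b s * 6 powr \<delta> s) * R powr \<delta> s"
    and x: "\<And>j. x j \<in> \<Omega>s j"
  obtains Y where "finite Y"
    "(\<Prod>j\<in>UNIV. a j / (b j * 6 powr \<delta> j) * R powr ((1 + i j) * \<delta> j)) / 2 \<le> card Y"
    "\<And>y j. y \<in> Y \<Longrightarrow> y j \<in> \<Omega>s j"
    "\<And>y j. y \<in> Y \<Longrightarrow> dist (x j) (y j) \<le> box_radius i R n j - box_radius i R (Suc n) j"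
    "pairwise (\<lambda>y y'. \<exists>j. 2 * box_radius i R (Suc n) j < dist (y j) (y' j)) Y"
    "\<And>y z q p. y \<in> Y \<Longrightarrow> (\<And>j. dist (y j) (z j) \<le> box_radius i R (Suc n) j) \<Longrightarrow>
      q \<in> gaussian_ints \<Longrightarrow> q \<noteq> 0 \<Longrightarrow> cmod q < R ^ Suc n \<Longrightarrow> (\<And>s. p s \<in> gaussian_ints) \<Longrightarrow>
      \<exists>s. 0 < i s \<and> box_radius i R (Suc n) s \<le> cmod (z s - p s / q)"
proof -
  interpret ahlfors_regular_family m \<Omega>s \<delta> a b by fact
  define h where "h = box_radius i R (Suc n)"
  define r where "r = box_radius i R n"
  define S where "S = {s. 0 < i s}"
  have h_pos: "0 < h j" for j using R by (simp add: h_def box_radius_pos)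
  have h_r: "4 * h j \<le> r j" for j
  proof -
    have "4 * h j \<le> R * h j" using R h_pos[of j] by simp
    also have "\<dots> \<le> r j" unfolding h_def r_def using R i_nonneg by (intro box_radius_Suc_le) auto
    finally show ?thesis .
  qed
  have r_pos: "0 < r j" for j using R by (simp add: r_def box_radius_pos)
  have r_le: "r j \<le> 1" for j
  proof -
    have "r j \<le> 1 / R ^ n" unfolding r_def using R i_nonneg by (intro box_radius_le) auto
    also have "\<dots> \<le> 1" using R one_le_power[of R n] by simp
    finally show ?thesis .
  qed
  have h_le: "h j \<le> 1" for j using h_r[of j] r_le[of j] h_pos[of j] by linarith
  \<comment> \<open>Radius \<open>r j - h j\<close> keeps the child boxes inside the parent
    box.\<close>
  have "\<exists>Y. finite Y \<and> Y \<subseteq> \<Omega>s j \<inter> cball (x j) (r j - h j) \<and> pairwise (\<lambda>x y. 2 * h j < dist x y) Y \<and>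
      (\<forall>y \<in> \<Omega>s j \<inter> cball (x j) (r j - h j). \<exists>y'\<in>Y. dist y y' \<le> 2 * h j)" for j
    using ahlfors_regular.maximal_separated_subset[OF regular[of j] Int_lower1 h_pos[of j] h_le[of j]]
    by metis
  then obtain Y where Y: "\<And>j. finite (Y j)" "\<And>j. Y j \<subseteq> \<Omega>s j \<inter> cball (x j) (r j - h j)"
    "\<And>j. pairwise (\<lambda>x y. 2 * h j < dist x y) (Y j)"
    "\<And>j y. y \<in> \<Omega>s j \<inter> cball (x j) (r j - h j) \<Longrightarrow> \<exists>y'\<in>Y j. dist y y' \<le> 2 * h j"
    by metis
  let ?c = "\<lambda>j. a j / (b j * 6 powr \<delta> j) * R powr ((1 + i j) * \<delta> j)"
  have card_Y: "?c j \<le> card (Y j)" for j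
  proof -
    \<comment> \<open>The ball of radius \<open>r j / 2\<close> lies in the ball from which
      \<open>Y j\<close> was taken, because \<open>4 * h j \<le> r j\<close>; its ratio to the
      radius \<open>3 * h j\<close> produces the 6.\<close>
    have "a j * (r j / 2) powr \<delta> j \<le> card (Y j) * (b j * (3 * h j) powr \<delta> j)"
    proof (rule ahlfors_regular.card_cover_ge[OF regular[of j] x])
      fix y assume "y \<in> \<Omega>s j" "y \<in> ball (x j) (r j / 2)"
      then show "\<exists>y'\<in>Y j. dist y y' \<le> 2 * h j" using h_r[of j] h_pos[of j] by (intro Y(4)) auto
    qed (use Y(1,2) h_pos r_pos r_le[of j] in auto)
    also have "(r j / 2) powr \<delta> j = (R powr (1 + i j) / 6 * (3 * h j)) powr \<delta> j"
      using R by (simp add: r_def h_def box_radius_Suc)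
    also have "\<dots> = (R powr (1 + i j) / 6) powr \<delta> j * (3 * h j) powr \<delta> j"
      by (rule powr_mult)
    finally have "(a j * (R powr (1 + i j) / 6) powr \<delta> j) * (3 * h j) powr \<delta> j
        \<le> (card (Y j) * b j) * (3 * h j) powr \<delta> j"
      by (simp only: mult.assoc)
    then have "a j * (R powr (1 + i j) / 6) powr \<delta> j \<le> card (Y j) * b j"
      using h_pos[of j] by (simp only: mult_le_cancel_right) simp
    then have "a j * (R powr ((1 + i j) * \<delta> j) / 6 powr \<delta> j) \<le> card (Y j) * b j"
      by (simp add: powr_divide powr_powr)
    then show ?thesis using pos[of j] by (simp add: field_simps)
  qed
  have "1 \<le> R" using R by simp
  from rationals_in_box_on_hyperplane[OF i_nonneg i_sum this, of n x, folded r_def S_def]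
  obtain \<alpha> \<beta> where \<alpha>: "\<exists>s\<in>S. \<alpha> s \<noteq> 0"
    and hyperplane: "\<And>q p. q \<in> gaussian_ints \<Longrightarrow> q \<noteq> 0 \<Longrightarrow> cmod q < R ^ Suc n \<Longrightarrow> (\<And>s. p s \<in> gaussian_ints) \<Longrightarrow>
      (\<And>s. 0 < i s \<Longrightarrow> cmod (p s / q - x s) \<le> 2 * r s) \<Longrightarrow> (\<Sum>s\<in>S. \<alpha> s * (p s / q)) + \<beta> = 0"
    by blast
  define near where "near = {y \<in> PiE UNIV Y. cmod ((\<Sum>s\<in>S. \<alpha> s * y s) + \<beta>) \<le> (\<Sum>s\<in>S. cmod (\<alpha> s) * (2 * h s))}"
  have "2 * card near \<le> (\<Prod>j\<in>UNIV. card (Y j))"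
    unfolding near_def
  proof (rule card_near_hyperplane_le[OF fam])
    fix s assume "s \<in> S"
    have "R powr \<delta> s \<le> R powr ((1 + i s) * \<delta> s)"
      using R i_nonneg[of s] pos(3)[of s] by (intro powr_mono) auto
    then have "a s / (b s * 6 powr \<delta> s) * R powr \<delta> s \<le> ?c s"
      using pos[of s] by (intro mult_left_mono) auto
    then show "2 * (b s / a s * (8 * CARD('n)) powr \<delta> s) \<le> card (Y s)"
      using large[of s] card_Y[of s] \<open>s \<in> S\<close> by (auto simp: S_def)
  qed (use Y h_pos h_le \<alpha> in auto)
  have fin: "finite (PiE UNIV Y)" using Y(1) by (intro finite_PiE) auto
  have near_sub: "near \<subseteq> PiE UNIV Y" by (auto simp: near_def)
  \<comment> \<open>If \<open>z\<close> were within \<open>h s\<close> of \<open>p / q\<close> in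
    all coordinates of \<open>S\<close>, the centre \<open>y\<close> would be within
    \<open>2 * h s\<close> of it and \<open>p / q\<close> within \<open>2 * r s\<close> of
    \<open>x\<close>. Then \<open>p / q\<close> would lie on the hyperplane and \<open>y\<close> in
    \<open>near\<close>.\<close>
  have far_hyperplane: "\<exists>s. 0 < i s \<and> h s \<le> cmod (z s - p s / q)"
    if y: "y \<in> PiE UNIV Y - near" and z: "\<And>j. dist (y j) (z j) \<le> h j"
      and q: "q \<in> gaussian_ints" "q \<noteq> 0" "cmod q < R ^ Suc n" and p: "\<And>s. p s \<in> gaussian_ints" for y z q p
  proof (rule ccontr)
    assume "\<not> ?thesis"
    then have close: "cmod (z s - p s / q) < h s" if "s \<in> S" for s using that by (auto simp: S_def not_le)
    have y_near: "cmod (y s - p s / q) \<le> 2 * h s" if "s \<in> S" for s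
      using z[of s] close[OF that] norm_triangle_ineq[of "y s - z s" "z s - p s / q"]
      by (simp add: dist_norm)
    have "(\<Sum>s\<in>S. \<alpha> s * (p s / q)) + \<beta> = 0"
    proof (rule hyperplane[OF q p])
      fix s assume "0 < i s"
      have "y s \<in> Y s" using y by (auto simp: PiE_iff)
      then have "cmod (x s - y s) \<le> r s - h s" using Y(2)[of s] by (auto simp: dist_norm)
      then show "cmod (p s / q - x s) \<le> 2 * r s"
        using y_near[of s] \<open>0 < i s\<close> h_r[of s] h_pos[of s] norm_triangle_ineq[of "x s - y s" "y s - p s / q"]
        by (simp add: S_def norm_minus_commute)
    qed
    then have "(\<Sum>s\<in>S. \<alpha> s * y s) + \<beta> = (\<Sum>s\<in>S. \<alpha> s * y s) + \<beta> - ((\<Sum>s\<in>S. \<alpha> s * (p s / q)) + \<beta>)"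
      by simp
    also have "\<dots> = (\<Sum>s\<in>S. \<alpha> s * (y s - p s / q))"
      by (simp add: right_diff_distrib sum_subtractf)
    also have "cmod \<dots> \<le> (\<Sum>s\<in>S. cmod (\<alpha> s) * (2 * h s))"
      using y_near by (intro sum_norm_le) (simp add: norm_mult mult_left_mono)
    finally show False using y by (simp add: near_def)
  qed
  show thesis
  proof (rule that[of "PiE UNIV Y - near"])
    have "(\<Prod>j\<in>UNIV. ?c j) \<le> (\<Prod>j\<in>UNIV. real (card (Y j)))"
      using card_Y pos by (intro prod_mono) (auto simp: less_imp_le)
    also have "\<dots> = real (\<Prod>j\<in>UNIV. card (Y j))" by simp
    also have "\<dots> \<le> real (2 * card (PiE UNIV Y - near))"
      using \<open>2 * card near \<le> _\<close> card_Diff_subset[OF finite_subset[OF near_sub fin] near_sub]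
      by (intro of_nat_mono) (simp add: card_PiE)
    finally show "(\<Prod>j\<in>UNIV. ?c j) / 2 \<le> card (PiE UNIV Y - near)" by simp
    show "finite (PiE UNIV Y - near)" using fin by simp
    show "y j \<in> \<Omega>s j" "dist (x j) (y j) \<le> box_radius i R n j - box_radius i R (Suc n) j"
      if "y \<in> PiE UNIV Y - near" for y j
      using that Y(2)[of j] unfolding r_def h_def by (auto simp: PiE_iff)
    show "pairwise (\<lambda>y y'. \<exists>j. 2 * box_radius i R (Suc n) j < dist (y j) (y' j)) (PiE UNIV Y - near)"
    proof (rule pairwiseI)
      fix y y' assume "y \<in> PiE UNIV Y - near" "y' \<in> PiE UNIV Y - near" "y \<noteq> y'"
      then obtain j where "y j \<noteq> y' j" "y j \<in> Y j" "y' j \<in> Y j" by (auto simp: PiE_iff fun_eq_iff)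
      then show "\<exists>j. 2 * box_radius i R (Suc n) j < dist (y j) (y' j)"
        using pairwiseD[OF Y(3)] unfolding h_def by blast
    qed
  qed (use far_hyperplane in \<open>auto simp: h_def\<close>)
qed

subsection \<open>Dimension of the product\<close>

text \<open>The upper bound is extended to large radii by the total mass, and the lower bound to all
  radii up to 1 by passing to the ball of radius \<open>r * r1\<close>; both only change the
  constants.\<close>

lemma ahlfors_regular_of_condition_A:
  fixes \<mu> :: "complex measure"
  assumes "compact \<Omega>" "sets \<mu> = sets borel" "finite_measure \<mu>" "\<And>x. emeasure \<mu> {x} = 0"
    "emeasure \<mu> (UNIV - \<Omega>) = 0" "condition_A \<mu> \<Omega> \<delta>" "\<Omega> \<noteq> {}"
  obtains a b where "ahlfors_regular \<mu> \<Omega> \<delta> a b"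
proof -
  interpret finite_measure \<mu> by fact
  have ball_sets: "ball c r \<in> sets \<mu>" for c r using assms(2) by simp
  from assms(6) obtain r0 a b where r0: "0 < r0" and ab: "0 < a" "a \<le> 1" "1 \<le> b"
    and A: "\<And>c r. c \<in> \<Omega> \<Longrightarrow> 0 < r \<Longrightarrow> r \<le> r0 \<Longrightarrow> ennreal (a * r powr \<delta>) \<le> emeasure \<mu> (ball c r) \<and>
        emeasure \<mu> (ball c r) \<le> ennreal (b * r powr \<delta>)"
    unfolding condition_A_def by blast
  have lower: "a * r powr \<delta> \<le> measure \<mu> (ball c r)" and upper: "measure \<mu> (ball c r) \<le> b * r powr \<delta>"
    if "c \<in> \<Omega>" "0 < r" "r \<le> r0" for c r
    using A[OF that] ab by (simp_all add: emeasure_eq_measure)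
  define r1 where "r1 = min r0 1"
  have r1: "0 < r1" "r1 \<le> 1" "r1 \<le> r0" using r0 by (auto simp: r1_def)
  \<comment> \<open>Nonatomicity forces this: for \<open>\<delta> \<le> 0\<close> the balls
    shrinking to \<open>c\<close> would all have mass at least \<open>a\<close>, while their masses
    tend to that of \<open>{c}\<close>.\<close>
  have "0 < \<delta>"
  proof (rule ccontr)
    assume "\<not> 0 < \<delta>"
    obtain c where c: "c \<in> \<Omega>" using assms(7) by blast
    have "(\<lambda>n. measure \<mu> (ball c (r1 / Suc n))) \<longlonglongrightarrow> measure \<mu> (\<Inter>n. ball c (r1 / Suc n))"
      using r1(1) by (intro finite_Lim_measure_decseq)
        (auto simp: ball_sets decseq_def intro!: subset_ball divide_left_mono)
    also have "(\<Inter>n. ball c (r1 / Suc n)) = {c}"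
    proof (intro equalityI subsetI)
      fix x assume "x \<in> (\<Inter>n. ball c (r1 / Suc n))"
      then have "dist c x \<le> r1 / Suc n" for n by (auto simp: less_imp_le)
      moreover have "(\<lambda>n. r1 / Suc n) \<longlonglongrightarrow> 0" by (rule LIMSEQ_Suc) (rule lim_const_over_n)
      ultimately have "dist c x \<le> 0" by (intro LIMSEQ_le_const) auto
      then show "x \<in> {c}" by simp
    qed (use r1 in auto)
    finally have lim: "(\<lambda>n. measure \<mu> (ball c (r1 / Suc n))) \<longlonglongrightarrow> 0" using assms(4) by (simp add: measure_def)
    have "a \<le> measure \<mu> (ball c (r1 / Suc n))" for n
    proof -
      have "r1 / Suc n \<le> r1 / 1" using r1 by (intro divide_left_mono) auto
      then have r: "0 < r1 / Suc n" "r1 / Suc n \<le> 1" "r1 / Suc n \<le> r0" using r1 by auto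
      have "(r1 / Suc n) powr 0 \<le> (r1 / Suc n) powr \<delta>"
        using \<open>\<not> 0 < \<delta>\<close> r by (intro powr_mono') auto
      then have "a * 1 \<le> a * (r1 / Suc n) powr \<delta>" using ab(1) r r1(1) by (intro mult_left_mono) auto
      then show ?thesis using lower[OF c r(1,3)] by linarith
    qed
    then have "a \<le> 0" using lim by (intro LIMSEQ_le_const) auto
    then show False using ab by simp
  qed
  show thesis
  proof (rule that, unfold_locales)
    show "closed \<Omega>" using assms(1) by (rule compact_imp_closed)
    show "0 < a * r1 powr \<delta>" using ab r1 by simp
    show "0 < b + measure \<mu> UNIV / r1 powr \<delta>" using ab by (simp add: add_pos_nonneg)
    fix c r assume c: "c \<in> \<Omega>" and r: "0 < (r::real)"
    show "measure \<mu> (ball c r) \<le> (b + measure \<mu> UNIV / r1 powr \<delta>) * r powr \<delta>"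
    proof (cases "r \<le> r0")
      case True
      then have "measure \<mu> (ball c r) \<le> b * r powr \<delta>" using upper c r by blast
      also have "\<dots> \<le> (b + measure \<mu> UNIV / r1 powr \<delta>) * r powr \<delta>"
        by (intro mult_right_mono) auto
      finally show ?thesis .
    next
      case False
      have "measure \<mu> (ball c r) \<le> measure \<mu> UNIV" using assms(2) by (intro finite_measure_mono) auto
      also have "\<dots> = measure \<mu> UNIV / r1 powr \<delta> * r1 powr \<delta>" using r1 by simp
      also have "\<dots> \<le> (b + measure \<mu> UNIV / r1 powr \<delta>) * r powr \<delta>"
        using False r1 ab \<open>0 < \<delta>\<close> by (intro mult_mono powr_mono2) auto
      finally show ?thesis .
    qed
    assume "r \<le> 1"
    have "a * r1 powr \<delta> * r powr \<delta> = a * (r * r1) powr \<delta>" by (simp add: powr_mult)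
    also have "\<dots> \<le> measure \<mu> (ball c (r * r1))"
      using r r1 \<open>r \<le> 1\<close> order_trans[OF mult_left_le_one_le r1(3), of r]
      by (intro lower[OF c]) (auto simp: mult.commute)
    also have "\<dots> \<le> measure \<mu> (ball c r)"
      using r r1 mult_left_mono[of r1 1 r]
      by (intro finite_measure_mono subset_ball) (auto simp: ball_sets)
    finally show "a * r1 powr \<delta> * r powr \<delta> \<le> measure \<mu> (ball c r)" .
  qed (use assms \<open>0 < \<delta>\<close> in auto)
qed

lemma dist_max_le_iff: "dist_max z w \<le> r \<longleftrightarrow> (\<forall>j. dist (z j) (w j) \<le> r)"
  by (simp add: dist_max_def dist_norm)

lemma hausdorff_outer_mono:
  assumes "S \<subseteq> T"
  shows "hausdorff_outer d s S \<le> hausdorff_outer d s T"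
  unfolding hausdorff_outer_def hausdorff_approx_def using assms
  by (intro SUP_mono' INF_superset_mono) auto

lemma hausdorff_dim_eqI:
  assumes "0 \<le> D" "\<And>s. s < D \<Longrightarrow> hausdorff_outer d s S \<noteq> 0" "\<And>s. D < s \<Longrightarrow> hausdorff_outer d s S = 0"
  shows "hausdorff_dim d S = D"
  unfolding hausdorff_dim_def
proof (rule antisym)
  let ?A = "{s. 0 \<le> s \<and> hausdorff_outer d s S = 0}"
  have ge: "D \<le> s" if "s \<in> ?A" for s using that assms(2) by (auto simp: not_less[symmetric])
  then have "bdd_below ?A" by (auto simp: bdd_below_def)
  moreover have "s \<in> ?A" if "D < s" for s using that assms by simp
  ultimately have "Inf ?A \<le> s" if "D < s" for s using that by (intro cInf_lower)
  then show "Inf ?A \<le> D" by (rule dense_ge)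
  \<comment> \<open>This witness gives the nonemptiness that a lower bound for \<open>Inf\<close> on
    the reals requires.\<close>
  have "D + 1 \<in> ?A" using assms by simp
  then show "D \<le> Inf ?A" using ge by (intro cInf_greatest) auto
qed

text \<open>Cubes centred at the points of a product of maximal separated sets cover the whole
  product, and the packing bound in each coordinate limits their number to a constant times
  \<open>h\<close> to the power minus \<open>\<Sum>j\<in>UNIV. \<delta> j\<close>.\<close>

lemma hausdorff_outer_product_eq_0:
  fixes m :: "'n::finite \<Rightarrow> complex measure"
  assumes fam: "ahlfors_regular_family m \<Omega>s \<delta> a b" and s: "(\<Sum>j\<in>UNIV. \<delta> j) < s"
  shows "hausdorff_outer dist_max s {z. \<forall>j. z j \<in> \<Omega>s j} = 0"
proof (rule hausdorff_outer_eq_0[where D = "\<Sum>j\<in>UNIV. \<delta> j" and C = "\<Prod>j\<in>UNIV. measure (m j) UNIV / a j"])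
  interpret ahlfors_regular_family m \<Omega>s \<delta> a b by fact
  interpret R: ahlfors_regular "m j" "\<Omega>s j" "\<delta> j" "a j" "b j" for j by (rule regular)
  let ?C = "\<Prod>j\<in>UNIV. measure (m j) UNIV / a j"
  show "0 < s" using s sum_nonneg[of UNIV \<delta>] pos(3) by (smt (verit) less_imp_le)
  show "0 \<le> ?C" using pos by (intro prod_nonneg) (auto simp: less_imp_le)
  fix h :: real assume h: "0 < h" "h \<le> 1"
  have "\<exists>Y. finite Y \<and> Y \<subseteq> \<Omega>s j \<and> pairwise (\<lambda>x y. 2 * h < dist x y) Y \<and>
      (\<forall>x\<in>\<Omega>s j. \<exists>y\<in>Y. dist x y \<le> 2 * h)" for j
    using R.maximal_separated_subset[OF order_refl h] by metis
  then obtain Y where Y: "\<And>j. finite (Y j)" "\<And>j. Y j \<subseteq> \<Omega>s j"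
    "\<And>j. pairwise (\<lambda>x y. 2 * h < dist x y) (Y j)"
    "\<And>j x. x \<in> \<Omega>s j \<Longrightarrow> \<exists>y\<in>Y j. dist x y \<le> 2 * h" by metis
  define box where "box = (\<lambda>y::'n \<Rightarrow> complex. {z. \<forall>j. dist (z j) (y j) \<le> 2 * h})"
  have "real (card (box ` PiE UNIV Y)) \<le> (\<Prod>j\<in>UNIV. real (card (Y j)))"
    using card_image_le[of "PiE UNIV Y" box] Y(1) finite_PiE[of UNIV Y]
    by (simp add: card_PiE flip: of_nat_prod)
  then have "real (card (box ` PiE UNIV Y)) * h powr (\<Sum>j\<in>UNIV. \<delta> j)
      \<le> (\<Prod>j\<in>UNIV. real (card (Y j))) * (\<Prod>j\<in>UNIV. h powr \<delta> j)"
    using h by (simp add: powr_sum mult_right_mono prod_nonneg)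
  also have "\<dots> = (\<Prod>j\<in>UNIV. card (Y j) * h powr \<delta> j)" by (simp add: prod.distrib)
  also have "\<dots> \<le> ?C"
  proof (rule prod_mono, safe)
    fix j
    have "card (Y j) * (a j * h powr \<delta> j) \<le> measure (m j) UNIV"
      using Y h by (intro R.card_separated_le_measure) (auto simp: R.sets_eq)
    then show "card (Y j) * h powr \<delta> j \<le> measure (m j) UNIV / a j"
      using pos(1)[of j] by (simp add: field_simps)
  qed auto
  finally have "real (card (box ` PiE UNIV Y)) * h powr (\<Sum>j\<in>UNIV. \<delta> j) \<le> ?C" .
  moreover have "{z. \<forall>j. z j \<in> \<Omega>s j} \<subseteq> \<Union>(box ` PiE UNIV Y)"
  proof
    fix z assume "z \<in> {z. \<forall>j. z j \<in> \<Omega>s j}"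
    then have "\<forall>j. \<exists>y. y \<in> Y j \<and> dist (z j) y \<le> 2 * h" using Y(4) by blast
    from choice[OF this] obtain y where "\<forall>j. y j \<in> Y j \<and> dist (z j) (y j) \<le> 2 * h" by blast
    then have "y \<in> PiE UNIV Y" "z \<in> box y" by (auto simp: box_def)
    then show "z \<in> \<Union>(box ` PiE UNIV Y)" by blast
  qed
  moreover have "diamE dist_max (box y) \<le> ennreal (4 * h)" for y
  proof (rule diamE_leI)
    fix z w assume "z \<in> box y" "w \<in> box y"
    then have "dist (z j) (w j) \<le> 4 * h" for j
      using dist_triangle2[of "z j" "w j" "y j"] unfolding box_def by (smt (verit) mem_Collect_eq)
    then show "dist_max z w \<le> 4 * h" by (simp add: dist_max_le_iff)
  qed
  moreover have "finite (box ` PiE UNIV Y)" using Y(1) by (intro finite_imageI finite_PiE) auto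
  ultimately show "\<exists>F. finite F \<and> {z. \<forall>j. z j \<in> \<Omega>s j} \<subseteq> \<Union>F \<and>
      (\<forall>U\<in>F. diamE dist_max U \<le> ennreal (4 * h)) \<and> real (card F) * h powr (\<Sum>j\<in>UNIV. \<delta> j) \<le> ?C"
    by (intro exI[of _ "box ` PiE UNIV Y"]) auto
qed (fact s)

section \<open>Estimates for bad approximability and for the choice of \<open>R\<close>\<close>

lemma eventually_le_powr:
  fixes c e :: real
  assumes "0 < e"
  shows "\<forall>\<^sub>F R in at_top. c \<le> R powr e"
  using eventually_ge_at_top[of "\<bar>c\<bar> powr (1 / e)"]
proof eventually_elim
  case (elim R)
  have "c \<le> (\<bar>c\<bar> powr (1 / e)) powr e" using assms by (simp add: powr_powr)
  also have "\<dots> \<le> R powr e" using elim assms by (intro powr_mono2) auto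
  finally show ?case .
qed

text \<open>Translates the scale of generation \<open>Suc n\<close> into a power of
  \<open>t\<close>, which stands for \<open>cmod q\<close>. Passing from \<open>n\<close> to
  \<open>Suc n\<close> costs \<open>R powr (1 + i s) \<le> R\<^sup>2\<close>, which together with
  the denominator of \<open>box_radius\<close> makes up \<open>R ^ 4\<close>.\<close>

lemma box_radius_ge_norm:
  fixes i :: "'n::finite \<Rightarrow> real"
  assumes "1 \<le> R" "0 < i s" "i s \<le> 1" "R ^ n \<le> t"
  shows "1 / (40 * real CARD('n) * R ^ 4) / t powr i s \<le> t * box_radius i R (Suc n) s"
proof -
  have "1 \<le> t" using assms one_le_power[of R n] by linarith
  have "R powr (real (Suc n) * (1 + i s)) = (R ^ n) powr (1 + i s) * R powr (1 + i s)"
    using assms by (simp add: powr_add powr_powr algebra_simps flip: powr_realpow)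
  also have "\<dots> \<le> t powr (1 + i s) * R powr 2"
    using assms by (intro mult_mono powr_mono2 powr_mono) auto
  also have "\<dots> = t * t powr i s * R\<^sup>2"
    using assms \<open>1 \<le> t\<close> by (simp add: powr_add powr_numeral)
  finally have "1 / (t * t powr i s * R\<^sup>2) \<le> R powr (- (real (Suc n) * (1 + i s)))"
    using assms \<open>1 \<le> t\<close> unfolding powr_minus_divide by (intro divide_left_mono) auto
  then have "t * (1 / (t * t powr i s * R\<^sup>2) / (40 * real CARD('n) * R\<^sup>2)) \<le> t * box_radius i R (Suc n) s"
    unfolding box_radius_def using \<open>1 \<le> t\<close> by (intro mult_left_mono divide_right_mono) auto
  moreover have "t * (1 / (t * t powr i s * R\<^sup>2) / (40 * real CARD('n) * R\<^sup>2))
      = 1 / (40 * real CARD('n) * R ^ 4) / t powr i s"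
    using \<open>1 \<le> t\<close> assms by (simp add: field_simps power4_eq_xxxx power2_eq_square)
  ultimately show ?thesis by simp
qed

text \<open>Every nonzero \<open>q\<close> has \<open>R ^ n \<le> cmod q < R ^ Suc n\<close> for
  some \<open>n\<close>, and \<open>far\<close> for this \<open>n\<close> gives a coordinate with
  \<open>cmod (q * z s - p s)\<close> at least a constant over \<open>cmod q powr i s\<close>;
  raising to the power \<open>1 / i s\<close> gives the required bound.\<close>

lemma Bad_C_I:
  fixes i :: "'n::finite \<Rightarrow> real"
  assumes i_nonneg: "\<And>j. 0 \<le> i j" and i_sum: "(\<Sum>j\<in>UNIV. i j) = 1" and R: "1 < R"
    and far: "\<And>n q p. q \<in> gaussian_ints \<Longrightarrow> q \<noteq> 0 \<Longrightarrow> cmod q < R ^ Suc n \<Longrightarrow> (\<And>s. p s \<in> gaussian_ints) \<Longrightarrow>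
      \<exists>s. 0 < i s \<and> box_radius i R (Suc n) s \<le> cmod (z s - p s / q)"
  shows "z \<in> Bad_C i"
proof -
  define S where "S = {s. i s \<noteq> 0}"
  have "S \<noteq> {}"
  proof
    assume "S = {}"
    then have "i = (\<lambda>_. 0)" by (auto simp: S_def)
    then show False using i_sum by simp
  qed
  define \<kappa> where "\<kappa> = 1 / (40 * real CARD('n) * R ^ 4)"
  have "0 < \<kappa>" using R by (simp add: \<kappa>_def)
  \<comment> \<open>The constant \<open>\<kappa> powr (1 / i s)\<close> depends on the coordinate,
    which varies with \<open>q\<close> and \<open>p\<close>, so the least of the finitely many
    values is taken.\<close>
  define c where "c = Min ((\<lambda>s. \<kappa> powr (1 / i s)) ` S)"
  have "0 < c" using \<open>S \<noteq> {}\<close> \<open>0 < \<kappa>\<close> by (simp add: c_def)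
  have "c / cmod q \<le> Max ((\<lambda>s. cmod (q * z s - p s) powr (1 / i s)) ` S)"
    if q: "q \<in> gaussian_ints" "q \<noteq> 0" and p: "\<And>s. p s \<in> gaussian_ints" for q p
  proof -
    have "1 \<le> cmod q" using gaussian_ints_norm_less_1 q by (meson not_le)
    obtain n where n: "R ^ n \<le> cmod q" "cmod q < R ^ Suc n"
    proof -
      obtain k where "cmod q < R ^ k" using real_arch_pow[OF R] by blast
      define k0 where "k0 = (LEAST k. cmod q < R ^ k)"
      have k0: "cmod q < R ^ k0" unfolding k0_def using \<open>cmod q < R ^ k\<close> by (rule LeastI)
      then have "k0 \<noteq> 0" using \<open>1 \<le> cmod q\<close> by (cases k0) auto
      then obtain n where "k0 = Suc n" by (cases k0) auto
      then have "\<not> cmod q < R ^ n" using not_less_Least[of n "\<lambda>k. cmod q < R ^ k"] by (simp add: k0_def)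
      then show ?thesis using that[of n] k0 \<open>k0 = Suc n\<close> by simp
    qed
    obtain s where s: "0 < i s" "box_radius i R (Suc n) s \<le> cmod (z s - p s / q)"
      using far[of q n p] q n(2) p by blast
    have "i s \<le> 1" using i_nonneg i_sum member_le_sum[of s UNIV i] by simp
    have "\<kappa> / cmod q powr i s \<le> cmod q * box_radius i R (Suc n) s"
      unfolding \<kappa>_def using R n(1) s(1) \<open>i s \<le> 1\<close> by (intro box_radius_ge_norm) auto
    also have "\<dots> \<le> cmod q * cmod (z s - p s / q)" using s(2) by (intro mult_left_mono) auto
    also have "\<dots> = cmod (q * z s - p s)"
      using q(2) by (simp add: right_diff_distrib flip: norm_mult)
    finally have "(\<kappa> / cmod q powr i s) powr (1 / i s) \<le> cmod (q * z s - p s) powr (1 / i s)"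
      using \<open>0 < \<kappa>\<close> s(1) by (intro powr_mono2) auto
    moreover have "(\<kappa> / cmod q powr i s) powr (1 / i s) = \<kappa> powr (1 / i s) / cmod q"
      using \<open>0 < \<kappa>\<close> s(1) q(2) by (simp add: powr_divide powr_powr)
    moreover have "c \<le> \<kappa> powr (1 / i s)" unfolding c_def using s(1) by (intro Min_le) (auto simp: S_def)
    ultimately have "c / cmod q \<le> cmod (q * z s - p s) powr (1 / i s)"
      by (smt (verit) divide_right_mono norm_ge_zero)
    also have "\<dots> \<le> Max ((\<lambda>s. cmod (q * z s - p s) powr (1 / i s)) ` S)"
      using s(1) by (intro Max_ge) (auto simp: S_def)
    finally show ?thesis .
  qed
  then show ?thesis unfolding Bad_C_def S_def using \<open>0 < c\<close> by blast
qed

text \<open>Up to the constants of regularity this is the product measure of a box of generation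
  \<open>n\<close>, against which the number \<open>M ^ n\<close> of boxes is weighed.\<close>

lemma prod_box_radius_powr:
  fixes i :: "'n::finite \<Rightarrow> real"
  assumes "1 \<le> R"
  shows "(\<Prod>j\<in>UNIV. box_radius i R n j powr \<delta> j)
    = (1 / (40 * real CARD('n) * R\<^sup>2)) powr (\<Sum>j\<in>UNIV. \<delta> j) * R powr (- (real n * (\<Sum>j\<in>UNIV. (1 + i j) * \<delta> j)))"
proof -
  have "box_radius i R n j powr \<delta> j
      = (1 / (40 * real CARD('n) * R\<^sup>2)) powr \<delta> j * R powr (- real n * ((1 + i j) * \<delta> j))" for j
    by (simp add: box_radius_def powr_divide powr_powr mult.assoc)
  moreover have "(1 / (40 * real CARD('n) * R\<^sup>2)) \<noteq> 0" "R \<noteq> 0" using assms by auto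
  ultimately show ?thesis
    by (simp add: prod.distrib sum_distrib_left sum_negf flip: powr_sum)
qed

subsection \<open>The lower bound\<close>

text \<open>The children from \<open>box_children\<close> form a \<open>box_tree\<close> whose limit
  points are badly approximable, and the branch measure satisfies the mass distribution principle
  for some \<open>t\<close> above \<open>s\<close>.\<close>

lemma hausdorff_outer_Bad_C_ne_0:
  fixes m :: "'n::finite \<Rightarrow> complex measure"
  assumes fam: "ahlfors_regular_family m \<Omega>s \<delta> a b"
    and i_nonneg: "\<And>j. 0 \<le> i j" and i_sum: "(\<Sum>j\<in>UNIV. i j) = 1"
    and nonempty: "\<And>j. \<Omega>s j \<noteq> {}" and s: "s < (\<Sum>j\<in>UNIV. \<delta> j)"
  shows "hausdorff_outer dist_max s (Bad_C i \<inter> {z. \<forall>j. z j \<in> \<Omega>s j}) \<noteq> 0"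
proof -
  interpret F: ahlfors_regular_family m \<Omega>s \<delta> a b by fact
  define \<Delta> where "\<Delta> = (\<Sum>j\<in>UNIV. \<delta> j)"
  define D where "D = (\<Sum>j\<in>UNIV. (1 + i j) * \<delta> j)"
  have "0 < \<Delta>" unfolding \<Delta>_def using F.pos(3) by (intro sum_pos) auto
  \<comment> \<open>The mass distribution principle wants a positive exponent, while
    \<open>s\<close> may be negative; hence the \<open>max\<close>.\<close>
  then obtain t where t: "max s 0 < t" "t < \<Delta>" using dense[of "max s 0" \<Delta>] s by (auto simp: \<Delta>_def)
  \<comment> \<open>This is the exponent that the loss of the factor \<open>\<kappa>\<close> in each
    generation may cost; \<open>R\<close> is chosen with
    \<open>\<kappa> * R powr \<eta> \<ge> 1\<close>.\<close>
  define \<eta> where "\<eta> = \<Delta> - t"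
  have "0 < \<eta>" using t by (simp add: \<eta>_def)
  define \<kappa> where "\<kappa> = (\<Prod>j\<in>UNIV. a j / (b j * 6 powr \<delta> j)) / 2"
  have "0 < \<kappa>" unfolding \<kappa>_def using F.pos by (simp add: prod_pos)
  let ?large = "\<lambda>R s. 2 * (b s / a s * (8 * CARD('n)) powr \<delta> s) / (a s / (b s * 6 powr \<delta> s)) \<le> R powr \<delta> s"
  have "\<forall>\<^sub>F R in at_top. \<forall>s. ?large R s"
    using F.pos(3) by (intro eventually_all_finite eventually_le_powr)
  moreover have "\<forall>\<^sub>F R in at_top. 1 / \<kappa> \<le> R powr \<eta>" using \<open>0 < \<eta>\<close> by (rule eventually_le_powr)
  ultimately have "\<forall>\<^sub>F R::real in at_top. (\<forall>s. ?large R s) \<and> 1 / \<kappa> \<le> R powr \<eta> \<and> 4 \<le> R"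
    by (intro eventually_conj eventually_ge_at_top)
  then obtain R :: real where R: "\<And>s. ?large R s" "1 / \<kappa> \<le> R powr \<eta>" "4 \<le> R"
    using eventually_happens'[OF trivial_limit_at_top_linorder] by blast
  have large: "2 * (b s / a s * (8 * CARD('n)) powr \<delta> s) \<le> a s / (b s * 6 powr \<delta> s) * R powr \<delta> s" for s
    using R(1)[of s] F.pos[of s] by (simp add: field_simps)
  let ?\<rho> = "box_radius i R"
  \<comment> \<open>Keeping exactly \<open>M\<close> children gives every node the same number.
    Rounding up is allowed because cardinalities are integers.\<close>
  define M where "M = nat \<lceil>\<kappa> * R powr D\<rceil>"
  have M: "\<kappa> * R powr D \<le> M" "0 < M" using \<open>0 < \<kappa>\<close> R(3) unfolding M_def by (simp_all add: le_of_int_ceiling)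
  define good where "good = (\<lambda>n x (f :: nat \<Rightarrow> 'n \<Rightarrow> complex).
    (\<forall>k<M. \<forall>j. f k j \<in> \<Omega>s j \<and> dist (x j) (f k j) \<le> ?\<rho> n j - ?\<rho> (Suc n) j) \<and>
    (\<forall>k<M. \<forall>l<M. k \<noteq> l \<longrightarrow> (\<exists>j. 2 * ?\<rho> (Suc n) j < dist (f k j) (f l j))) \<and>
    (\<forall>k<M. \<forall>z q p. (\<forall>j. dist (f k j) (z j) \<le> ?\<rho> (Suc n) j) \<longrightarrow> q \<in> gaussian_ints \<longrightarrow> q \<noteq> 0 \<longrightarrow>
      cmod q < R ^ Suc n \<longrightarrow> (\<forall>s. p s \<in> gaussian_ints) \<longrightarrow> (\<exists>s. 0 < i s \<and> ?\<rho> (Suc n) s \<le> cmod (z s - p s / q))))"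
  have good_ex: "\<exists>f. good n x f" if x: "\<And>j. x j \<in> \<Omega>s j" for n x
  proof (rule box_children[OF fam i_nonneg i_sum R(3) large x, of n])
    fix Y
    assume Y: "finite Y" "(\<Prod>j\<in>UNIV. a j / (b j * 6 powr \<delta> j) * R powr ((1 + i j) * \<delta> j)) / 2 \<le> card Y"
      "\<And>y j. y \<in> Y \<Longrightarrow> y j \<in> \<Omega>s j" "\<And>y j. y \<in> Y \<Longrightarrow> dist (x j) (y j) \<le> ?\<rho> n j - ?\<rho> (Suc n) j"
      "pairwise (\<lambda>y y'. \<exists>j. 2 * ?\<rho> (Suc n) j < dist (y j) (y' j)) Y"
      "\<And>y z q p. y \<in> Y \<Longrightarrow> (\<And>j. dist (y j) (z j) \<le> ?\<rho> (Suc n) j) \<Longrightarrow>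
        q \<in> gaussian_ints \<Longrightarrow> q \<noteq> 0 \<Longrightarrow> cmod q < R ^ Suc n \<Longrightarrow> (\<And>s. p s \<in> gaussian_ints) \<Longrightarrow>
        \<exists>s. 0 < i s \<and> ?\<rho> (Suc n) s \<le> cmod (z s - p s / q)"
    have "(\<Prod>j\<in>UNIV. a j / (b j * 6 powr \<delta> j) * R powr ((1 + i j) * \<delta> j)) / 2 = \<kappa> * R powr D"
      unfolding \<kappa>_def D_def prod.distrib using R(3) by (simp add: powr_sum)
    then have "M \<le> card Y" using Y(2) unfolding M_def by linarith
    then obtain Y' where Y': "Y' \<subseteq> Y" "card Y' = M" "finite Y'" by (rule obtain_subset_with_card_n)
    from ex_bij_betw_nat_finite[OF Y'(3)] obtain f where f: "bij_betw f {0..<M} Y'" using Y'(2) by auto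
    have fY: "f k \<in> Y" if "k < M" for k using f Y'(1) that by (auto simp: bij_betw_def)
    have f_inj: "f k \<noteq> f l" if "k < M" "l < M" "k \<noteq> l" for k l
      using f that by (auto simp: bij_betw_def inj_on_def)
    have "good n x f"
      unfolding good_def
    proof (intro conjI allI impI)
      fix k assume k: "k < M"
      show "f k j \<in> \<Omega>s j" "dist (x j) (f k j) \<le> ?\<rho> n j - ?\<rho> (Suc n) j" for j
        using Y(3,4) fY[OF k] by auto
      show "\<exists>j. 2 * ?\<rho> (Suc n) j < dist (f k j) (f l j)" if "l < M" "k \<noteq> l" for l
        using pairwiseD[OF Y(5) fY[OF k] fY[OF that(1)] f_inj[OF k that]] .
      fix z q and p :: "'n \<Rightarrow> complex"
      assume "\<forall>j. dist (f k j) (z j) \<le> ?\<rho> (Suc n) j" "q \<in> gaussian_ints" "q \<noteq> 0" "cmod q < R ^ Suc n"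
        "\<forall>s. p s \<in> gaussian_ints"
      then show "\<exists>s. 0 < i s \<and> ?\<rho> (Suc n) s \<le> cmod (z s - p s / q)"
        using Y(6)[OF fY[OF k], of z q p] by blast
    qed
    then show ?thesis by blast
  qed
  \<comment> \<open>One choice function of generation and centre serves the whole tree, as
    \<open>good_ex\<close> covers every centre in the product.\<close>
  define child where "child = (\<lambda>n x. SOME f. good n x f)"
  have child: "good n x (child n x)" if "\<And>j. x j \<in> \<Omega>s j" for n x
    unfolding child_def using someI_ex[OF good_ex[OF that]] .
  have "\<forall>j. \<exists>y. y \<in> \<Omega>s j" using nonempty by blast
  from choice[OF this] obtain x0 where x0: "\<And>j. x0 j \<in> \<Omega>s j" by blast
  have rad_le: "?\<rho> n j \<le> 1 / R ^ n" for n j using R(3) i_nonneg by (intro box_radius_le) auto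
  interpret T: box_tree m \<Omega>s \<delta> a b ?\<rho> x0 child M
  proof
    show pos: "0 < ?\<rho> n j" for n j using R(3) by (intro box_radius_pos) auto
    show "?\<rho> n j \<le> 1" for n j
      using rad_le[of n j] R(3) one_le_power[of R n] by (smt (verit) divide_le_eq_1_pos)
    show "(\<lambda>n. ?\<rho> n j) \<longlonglongrightarrow> 0" for j
    proof (rule tendsto_sandwich[of "\<lambda>_. 0" _ _ "\<lambda>n. 1 / R ^ n"])
      show "(\<lambda>n. 1 / R ^ n) \<longlonglongrightarrow> 0"
        using LIMSEQ_inverse_realpow_zero[of R] R(3) by (simp add: inverse_eq_divide)
    qed (use rad_le pos in \<open>auto simp: less_imp_le\<close>)
    fix x :: "'n \<Rightarrow> complex" and n k l
    assume x: "\<And>j. x j \<in> \<Omega>s j" and k: "k < M"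
    show "child n x k j \<in> \<Omega>s j" "dist (x j) (child n x k j) \<le> ?\<rho> n j - ?\<rho> (Suc n) j" for j
      using child[OF x] k by (auto simp: good_def)
    assume "l < M" "k \<noteq> l"
    then show "\<exists>j. 2 * ?\<rho> (Suc n) j < dist (child n x k j) (child n x l j)"
      using child[OF x] k by (auto simp: good_def)
  qed (use M x0 in auto)
  define A0 where "A0 = (\<Prod>j\<in>UNIV. a j)"
  define B0 where "B0 = (\<Prod>j\<in>UNIV. b j)"
  define \<epsilon> where "\<epsilon> = 1 / (40 * real CARD('n) * R\<^sup>2)"
  \<comment> \<open>The value is read off from the last step of the estimate below, where
    \<open>(6 * r) powr \<Delta>\<close> is divided by \<open>(r / R) powr \<eta>\<close>.\<close>
  define C where "C = B0 * 6 powr \<Delta> * R powr \<eta> / (A0 * \<epsilon> powr \<Delta>)"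
  have pos0: "0 < A0" "0 < B0" "0 < \<epsilon>" using F.pos R(3) by (auto simp: A0_def B0_def \<epsilon>_def prod_pos)
  show ?thesis
  proof (rule mass_distribution_principle[where M = T.branches and \<xi> = T.limit_point and t = t and C = C and ?r1.0 = 1])
    show "T.limit_point \<omega> \<in> Bad_C i \<inter> {z. \<forall>j. z j \<in> \<Omega>s j}" if \<omega>: "\<omega> \<in> space T.branches" for \<omega>
    proof -
      have "T.limit_point \<omega> \<in> Bad_C i"
      proof (rule Bad_C_I[OF i_nonneg i_sum])
        fix n q and p :: "'n \<Rightarrow> complex"
        assume "q \<in> gaussian_ints" "q \<noteq> 0" "cmod q < R ^ Suc n" "\<And>s. p s \<in> gaussian_ints"
        moreover have "good n (T.node \<omega> n) (child n (T.node \<omega> n))"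
          using T.node_in[OF \<omega>] by (rule child)
        moreover have "\<omega> n < M" using \<omega> by (simp add: T.space_branches)
        moreover have "\<forall>j. dist (child n (T.node \<omega> n) (\<omega> n) j) (T.limit_point \<omega> j) \<le> ?\<rho> (Suc n) j"
          using T.limit_point_near[OF \<omega>, of "Suc n"] by simp
        ultimately show "\<exists>s. 0 < i s \<and> ?\<rho> (Suc n) s \<le> cmod (T.limit_point \<omega> s - p s / q)"
          unfolding good_def by blast
      qed (use R(3) in auto)
      then show ?thesis using T.limit_point_in[OF \<omega>] by simp
    qed
    fix U :: "('n \<Rightarrow> complex) set" and r :: real
    assume U: "diamE dist_max U \<le> ennreal r" and r: "0 < r" "r \<le> 1"
    \<comment> \<open>The generation is the first with \<open>1 / R ^ n \<le> r\<close>; minimality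
      gives the reverse bound up to the factor \<open>R\<close>, with \<open>r \<le> 1\<close>
      covering \<open>n = 0\<close>.\<close>
    obtain n where n: "1 / R ^ n \<le> r" "r / R \<le> 1 / R ^ n"
    proof -
      obtain k where "1 / r < R ^ k" using real_arch_pow[of R] R(3) by force
      then have k: "1 / R ^ k \<le> r" using r(1) R(3) by (simp add: field_simps)
      define n where "n = (LEAST k. 1 / R ^ k \<le> r)"
      have n: "1 / R ^ n \<le> r" unfolding n_def using k by (rule LeastI)
      have "r / R \<le> 1 / R ^ n"
      proof (cases n)
        case 0
        then show ?thesis using r R(3) by simp
      next
        case (Suc k)
        then have "\<not> 1 / R ^ k \<le> r" using not_less_Least[of k "\<lambda>k. 1 / R ^ k \<le> r"] by (simp add: n_def)
        then have "r / R \<le> (1 / R ^ k) / R" using R(3) by (intro divide_right_mono) auto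
        then show ?thesis using Suc by (simp add: mult.commute)
      qed
      with n show ?thesis using that by blast
    qed
    have "dist (x j) (y j) \<le> r" if "x \<in> U" "y \<in> U" for x y j
      using diamE_leD[OF U _ that] r by (simp add: dist_max_le_iff)
    moreover have "?\<rho> n j \<le> r" for j using rad_le[of n j] n(1) by linarith
    ultimately obtain A where A: "A \<in> sets T.branches" "{\<omega>\<in>space T.branches. T.limit_point \<omega> \<in> U} \<subseteq> A"
      "measure T.branches A * (real M ^ n * (\<Prod>j\<in>UNIV. a j * ?\<rho> n j powr \<delta> j))
        \<le> (\<Prod>j\<in>UNIV. b j * (6 * r) powr \<delta> j)"
      using T.measure_limit_points_le[of U r n] by blast
    \<comment> \<open>This is where the choice of \<open>R\<close> pays for \<open>\<kappa>\<close>: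
      each node has at least \<open>R powr (D - \<eta>)\<close> children.\<close>
    have "R powr (D - \<eta>) \<le> \<kappa> * R powr D"
      using R(2,3) \<open>0 < \<kappa>\<close> by (simp add: powr_diff field_simps)
    then have "R powr (D - \<eta>) \<le> M" using M(1) by linarith
    then have "(R powr (D - \<eta>)) ^ n \<le> real M ^ n" by (intro power_mono) auto
    moreover have "(R powr (D - \<eta>)) ^ n = R powr (n * D) * R powr (- (n * \<eta>))"
      using R(3) by (simp add: powr_power algebra_simps flip: powr_add)
    ultimately have M_pow: "R powr (n * D) * R powr (- (n * \<eta>)) \<le> real M ^ n" by simp
    have "(r / R) powr \<eta> \<le> (1 / R ^ n) powr \<eta>"
      using n(2) r R(3) \<open>0 < \<eta>\<close> by (intro powr_mono2) auto
    also have "1 / R ^ n = R powr (- real n)"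
      using R(3) by (simp add: powr_minus powr_realpow divide_inverse)
    also have "(R powr (- real n)) powr \<eta> = R powr (- (n * \<eta>))" by (simp add: powr_powr)
    finally have gap: "(r / R) powr \<eta> \<le> R powr (- (n * \<eta>))" .
    \<comment> \<open>The powers of \<open>R\<close> with exponent \<open>n * D\<close>, from the
      number and from the size of the boxes, cancel; what remains is
      \<open>R powr (- (n * \<eta>))\<close>, at least \<open>(r / R) powr \<eta>\<close>.\<close>
    have "A0 * \<epsilon> powr \<Delta> * (r / R) powr \<eta>
        \<le> A0 * \<epsilon> powr \<Delta> * (R powr (- (n * D)) * (R powr (n * D) * R powr (- (n * \<eta>))))"
    proof -
      have "R powr (- (n * D)) * (R powr (n * D) * R powr (- (n * \<eta>))) = R powr (- (n * \<eta>))"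
        using R(3) by (simp flip: powr_add)
      then have "(r / R) powr \<eta> \<le> R powr (- (n * D)) * (R powr (n * D) * R powr (- (n * \<eta>)))"
        using gap by (simp only:)
      then show ?thesis using pos0 by (intro mult_left_mono) auto
    qed
    also have "\<dots> \<le> A0 * \<epsilon> powr \<Delta> * (R powr (- (n * D)) * real M ^ n)"
      using M_pow pos0 by (intro mult_left_mono) auto
    also have "\<dots> = real M ^ n * (\<Prod>j\<in>UNIV. a j * ?\<rho> n j powr \<delta> j)"
      using R(3) by (simp add: A0_def \<epsilon>_def \<Delta>_def D_def prod.distrib prod_box_radius_powr)
    finally have "measure T.branches A * (A0 * \<epsilon> powr \<Delta> * (r / R) powr \<eta>)
        \<le> measure T.branches A * (real M ^ n * (\<Prod>j\<in>UNIV. a j * ?\<rho> n j powr \<delta> j))"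
      by (intro mult_left_mono) auto
    also note A(3)
    also have "(\<Prod>j\<in>UNIV. b j * (6 * r) powr \<delta> j) = B0 * (6 * r) powr \<Delta>"
      using r(1) by (simp add: B0_def \<Delta>_def prod.distrib powr_sum)
    finally have "measure T.branches A \<le> B0 * (6 * r) powr \<Delta> / (A0 * \<epsilon> powr \<Delta> * (r / R) powr \<eta>)"
      using pos0 r(1) R(3) by (subst pos_le_divide_eq) auto
    also have "\<dots> = C * r powr t"
      using r(1) R(3) by (simp add: C_def \<eta>_def powr_mult powr_divide powr_diff field_simps)
    finally show "\<exists>A\<in>sets T.branches. {\<omega>\<in>space T.branches. T.limit_point \<omega> \<in> U} \<subseteq> A \<and>
        measure T.branches A \<le> C * r powr t" using A(1,2) by blast
  qed (use T.prob_space_branches t pos0 in \<open>auto simp: C_def\<close>)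
qed

text \<open>Both dimensions equal \<open>\<Sum>j\<in>UNIV. \<delta> j\<close>: nonvanishing below
  this value is proved for the smaller set, vanishing above it for the larger, and monotonicity of
  the outer measure supplies the other two facts.\<close>

theorem theorem9:
  fixes \<Omega>s :: "'n::finite \<Rightarrow> complex set"
    and m :: "'n \<Rightarrow> complex measure"
    and \<delta> :: "'n \<Rightarrow> real"
    and i :: "'n \<Rightarrow> real"
  assumes compact: "\<And>j. compact (\<Omega>s j)"
    and borel: "\<And>j. sets (m j) = sets borel"
    and finite: "\<And>j. finite_measure (m j)"
    and nonatomic: "\<And>j x. emeasure (m j) {x} = 0"
    and supported: "\<And>j. emeasure (m j) (UNIV - \<Omega>s j) = 0"
    and condA: "\<And>j. condition_A (m j) (\<Omega>s j) (\<delta> j)"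
    and i_nonneg: "\<And>j. 0 \<le> i j"
    and i_sum: "(\<Sum>j\<in>UNIV. i j) = 1"
  shows "hausdorff_dim dist_max (Bad_C i \<inter> {z. \<forall>j. z j \<in> \<Omega>s j})
           = hausdorff_dim dist_max {z. \<forall>j. z j \<in> \<Omega>s j}"
proof (cases "\<exists>j. \<Omega>s j = {}")
  \<comment> \<open>With an empty factor condition (A) is vacuous and does not make the exponent
    positive; both sets are then empty.\<close>
  case True
  then have "{z. \<forall>j. z j \<in> \<Omega>s j} = {}" by blast
  then show ?thesis by (simp only: Int_empty_right)
next
  case False
  let ?\<Omega> = "{z. \<forall>j. z j \<in> \<Omega>s j}" and ?\<Delta> = "\<Sum>j\<in>UNIV. \<delta> j"
  have "\<exists>a b. ahlfors_regular (m j) (\<Omega>s j) (\<delta> j) a b" for j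
    using ahlfors_regular_of_condition_A[OF compact borel finite nonatomic supported condA] False by metis
  then obtain a b where "\<And>j. ahlfors_regular (m j) (\<Omega>s j) (\<delta> j) (a j) (b j)" by metis
  then have fam: "ahlfors_regular_family m \<Omega>s \<delta> a b" by (rule ahlfors_regular_family.intro)
  have "0 \<le> ?\<Delta>" using ahlfors_regular_family.pos(3)[OF fam] by (intro sum_nonneg) (simp add: less_imp_le)
  moreover have lower: "hausdorff_outer dist_max s (Bad_C i \<inter> ?\<Omega>) \<noteq> 0" if "s < ?\<Delta>" for s
    using hausdorff_outer_Bad_C_ne_0[OF fam i_nonneg i_sum _ that] False by blast
  moreover have "hausdorff_outer dist_max s ?\<Omega> \<noteq> 0" if "s < ?\<Delta>" for s
    using lower[OF that] hausdorff_outer_mono[of "Bad_C i \<inter> ?\<Omega>" ?\<Omega> dist_max s] by auto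
  moreover have upper: "hausdorff_outer dist_max s ?\<Omega> = 0" if "?\<Delta> < s" for s
    using fam that by (rule hausdorff_outer_product_eq_0)
  moreover have "hausdorff_outer dist_max s (Bad_C i \<inter> ?\<Omega>) = 0" if "?\<Delta> < s" for s
    using upper[OF that] hausdorff_outer_mono[of "Bad_C i \<inter> ?\<Omega>" ?\<Omega> dist_max s] by auto
  ultimately show ?thesis by (simp add: hausdorff_dim_eqI[of ?\<Delta>])
qed

end
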